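(* Let $\mathcal{X}$ be a finite field with $q$ elements, let $\alpha\in\mathcal{X}$ be a primitive element, let $\gamma\in\mathcal{X}$ be non-zero, and let $G$ be the $q\times q$ Reed-Solomon kernel over $\mathcal{X}$, i.e. the matrix with rows and columns indexed by $0,\dots,q-1$ and entries $$G_{ij}=\alpha^{(q-2-j)(q-1-i)}\ \ (0\le i\le q-1,\ 0\le j\le q-2),\qquad G_{i,q-1}=0\ \ (0\le i\le q-2),\qquad G_{q-1,q-1}=\gamma.$$ Then the following hold. (1) If $q$ is prime, then for any $\gamma\neq0$ and any discrete memoryless channel $W$ with input alphabet $\mathcal{X}$, channel polarization occurs with kernel $G$: $P(I_\infty\in\{0,1\})=1$. For any finite field $\mathcal{X}$, if $\gamma$ is a primitive element of $\mathcal{X}$, then for any discrete memoryless channel $W$ with input alphabet $\mathcal{X}$, $P(I_\infty\in\{0,1\})=1$. (2) The partial distances of $G$ are $D^{[i]}=i+1$ for $i\in\{0,\dots,q-1\}$. Hence, with $\ell=q$, the exponent of $G$ is $E(G)=\frac1\ell\log_\ell(\ell!)$, and this exponent tends to $1$ as $\ell=q$ tends to infinity.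
   Context: Notation: $u_i^j=(u_i,\dots,u_j)$ denotes a row vector. A discrete memoryless channel (DMC) $W:\mathcal{X}\to\mathcal{Y}$ with finite input alphabet $\mathcal{X}$, $|\mathcal{X}|=q$, and at most countable output alphabet $\mathcal{Y}$ is a family of probability distributions $W(\cdot\mid x)$ on $\mathcal{Y}$, $x\in\mathcal{X}$. Its symmetric capacity, with logarithm to base $q$, is $$I(W)=\sum_{x\in\mathcal{X}}\sum_{y\in\mathcal{Y}}\frac1q W(y\mid x)\log_q\frac{W(y\mid x)}{\frac1q\sum_{x'\in\mathcal{X}}W(y\mid x')}\in[0,1].$$ Channel transform with an invertible $\ell\times\ell$ matrix $G$ over $\mathcal{X}$: set $W^\ell(y_0^{\ell-1}\mid x_0^{\ell-1})=\prod_{i=0}^{\ell-1}W(y_i\mid x_i)$, and for $i\in\{0,\dots,\ell-1\}$ define the DMC $W^{(i)}:\mathcal{X}\to\mathcal{Y}^\ell\times\mathcal{X}^{i}$ by $$W^{(i)}(y_0^{\ell-1},u_0^{i-1}\mid u_i)=\frac1{q^{\ell-1}}\sum_{u_{i+1}^{\ell-1}\in\mathcal{X}^{\ell-1-i}}W^\ell(y_0^{\ell-1}\mid u_0^{\ell-1}G).$$ Iterating, $W^{(b_1)\cdots(b_n)}=(W^{(b_1)\cdots(b_{n-1})})^{(b_n)}$. The sequence $B_1,B_2,\dots$ consists of independent random variables uniform on $\{0,\dots,\ell-1\}$. The sequence $I(W^{(B_1)\cdots(B_n)})$ converges almost surely to a random variable, denoted $I_\infty$. Partial distance of $G$: $D^{[i]}=\min_{v_{i+1}^{\ell-1},w_{i+1}^{\ell-1}}d\big((0_0^{i-1},0,v_{i+1}^{\ell-1})G,\,(0_0^{i-1},1,w_{i+1}^{\ell-1})G\big)$,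 where $0_0^{i-1}$ is the zero vector of length $i$ and $d$ is the Hamming distance on $\mathcal{X}^\ell$. The exponent of $G$ is $E(G)=\frac1\ell\sum_{i=0}^{\ell-1}\log_\ell D^{[i]}$. A primitive element of $\mathcal{X}$ is a generator of its multiplicative group. *)

theory Defs
  imports "HOL-Probability.Probability" "Jordan_Normal_Form.Matrix"
begin

text \<open>
  A channel with input alphabet \<open>'x\<close> and output alphabet \<open>'y\<close> is given by its transition
  probabilities: \<open>W x y\<close> is the probability of output \<open>y\<close> on input \<open>x\<close>.
\<close>

type_synonym ('x, 'y) channel = "'x \<Rightarrow> 'y \<Rightarrow> real"

definition dmc :: "('x, 'y) channel \<Rightarrow> bool" where
  "dmc W \<longleftrightarrow> (\<forall>x. (\<forall>y. 0 \<le> W x y) \<and> (W x has_sum 1) UNIV)"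

text \<open>
  The usual convention \<open>0 \<cdot> log 0 = 0\<close> for the terms with \<open>W x y = 0\<close> holds automatically.
\<close>

definition sym_capacity :: "('x::finite, 'y) channel \<Rightarrow> real" where
  "sym_capacity W =
     (\<Sum>x\<in>UNIV. \<Sum>\<^sub>\<infinity>y. 1 / real CARD('x) * W x y *
        log (real CARD('x)) (W x y / (1 / real CARD('x) * (\<Sum>x'\<in>UNIV. W x' y))))"

text \<open>Vectors over an alphabet are lists; \<open>vec_mat u G\<close> is the row vector \<open>u G\<close>.\<close>

definition vec_mat :: "'x::semiring_0 list \<Rightarrow> 'x mat \<Rightarrow> 'x list" where
  "vec_mat u G = map (\<lambda>j. scalar_prod (vec_of_list u) (col G j)) [0..<dim_col G]"

definition vector_channel :: "nat \<Rightarrow> ('x, 'y) channel \<Rightarrow> ('x list, 'y list) channel" where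
  "vector_channel l W xs ys = (\<Prod>i<l. W (xs ! i) (ys ! i))"

text \<open>
  The channel \<open>W\<^sup>(\<^sup>i\<^sup>)\<close>.  Its output alphabet consists of the pairs \<open>(ys, us)\<close> with
  \<open>length ys = l\<close> and \<open>length us = i\<close>; all other pairs of lists get probability zero.
\<close>

definition split_channel ::
    "'x::{finite,semiring_0} mat \<Rightarrow> ('x, 'y) channel \<Rightarrow> nat \<Rightarrow> ('x, 'y list \<times> 'x list) channel" where
  "split_channel G W i u = (\<lambda>(ys, us).
     let l = dim_row G in
     if length ys = l \<and> length us = i then
       1 / real CARD('x) ^ (l - 1) *
         (\<Sum>v | length v = l - 1 - i. vector_channel l W (vec_mat (us @ u # v) G) ys)
     else 0)"

text \<open>
  The output alphabet changes with every application of the transform.  To iterate it, the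
  alphabets of all levels are collected in one type: \<open>Letter\<close> embeds the original alphabet and
  \<open>Block\<close> embeds the pairs produced by one step.  Symbols outside the current alphabet have
  probability zero.
\<close>

datatype ('y, 'x) symbol = Letter 'y | Block "('y, 'x) symbol list" "'x list"

definition letter_channel :: "('x, 'y) channel \<Rightarrow> ('x, ('y, 'x) symbol) channel" where
  "letter_channel W x s = (case s of Letter y \<Rightarrow> W x y | Block ys us \<Rightarrow> 0)"

definition block_channel ::
    "('x, ('y, 'x) symbol list \<times> 'x list) channel \<Rightarrow> ('x, ('y, 'x) symbol) channel" where
  "block_channel V x s = (case s of Letter y \<Rightarrow> 0 | Block ys us \<Rightarrow> V x (ys, us))"

definition iter_channel ::
    "'x::{finite,semiring_0} mat \<Rightarrow> ('x, 'y) channel \<Rightarrow> nat list \<Rightarrow> ('x, ('y, 'x) symbol) channel" where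
  "iter_channel G W bs = foldl (\<lambda>V b. block_channel (split_channel G V b)) (letter_channel W) bs"

text \<open>\<open>B 1, B 2, \<dots>\<close> are independent and uniform on \<open>{0, \<dots>, l - 1}\<close>; \<open>B 0\<close> is not used.\<close>

definition iid_uniform :: "'m measure \<Rightarrow> nat \<Rightarrow> (nat \<Rightarrow> 'm \<Rightarrow> nat) \<Rightarrow> bool" where
  "iid_uniform M l B \<longleftrightarrow>
     prob_space.indep_vars M (\<lambda>_. count_space {..<l}) B {1..} \<and>
     (\<forall>n\<ge>1. distr M (count_space {..<l}) (B n) = uniform_count_measure {..<l})"

definition capacity_process ::
    "'x::{finite,semiring_0} mat \<Rightarrow> ('x, 'y) channel \<Rightarrow> (nat \<Rightarrow> 'm \<Rightarrow> nat) \<Rightarrow> nat \<Rightarrow> 'm \<Rightarrow> real" where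
  "capacity_process G W B n \<omega> = sym_capacity (iter_channel G W (map (\<lambda>k. B k \<omega>) [1..<Suc n]))"

definition capacity_limit ::
    "'x::{finite,semiring_0} mat \<Rightarrow> ('x, 'y) channel \<Rightarrow> (nat \<Rightarrow> 'm \<Rightarrow> nat) \<Rightarrow> 'm \<Rightarrow> real" where
  "capacity_limit G W B \<omega> = lim (\<lambda>n. capacity_process G W B n \<omega>)"

text \<open>
  \<open>lim\<close> is unspecified for divergent sequences; the first conjunct makes sure that
  \<open>capacity_limit\<close> is the almost sure limit of the capacities.
\<close>

definition polarizes ::
    "'m measure \<Rightarrow> (nat \<Rightarrow> 'm \<Rightarrow> nat) \<Rightarrow> 'x::{finite,semiring_0} mat \<Rightarrow> ('x, 'y) channel \<Rightarrow> bool" where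
  "polarizes M B G W \<longleftrightarrow>
     (AE \<omega> in M. (\<lambda>n. capacity_process G W B n \<omega>) \<longlonglongrightarrow> capacity_limit G W B \<omega>) \<and>
     measure M {\<omega> \<in> space M. capacity_limit G W B \<omega> \<in> {0, 1}} = 1"

definition hamming_dist :: "'x list \<Rightarrow> 'x list \<Rightarrow> nat" where
  "hamming_dist xs ys = card {j. j < length xs \<and> xs ! j \<noteq> ys ! j}"

definition partial_dist :: "'x::{finite,semiring_1} mat \<Rightarrow> nat \<Rightarrow> nat" where
  "partial_dist G i =
     Min {hamming_dist (vec_mat (replicate i 0 @ 0 # v) G) (vec_mat (replicate i 0 @ 1 # w) G) | v w.
            length v = dim_row G - 1 - i \<and> length w = dim_row G - 1 - i}"

definition exponent :: "'x::{finite,semiring_1} mat \<Rightarrow> real" where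
  "exponent G =
     1 / real (dim_row G) * (\<Sum>i<dim_row G. log (real (dim_row G)) (real (partial_dist G i)))"

text \<open>A generator of the multiplicative group.\<close>

definition primitive_element :: "'x::field \<Rightarrow> bool" where
  "primitive_element a \<longleftrightarrow> range (\<lambda>k::int. a powi k) = UNIV - {0}"

definition rs_kernel :: "'x::{finite,field} \<Rightarrow> 'x \<Rightarrow> 'x mat" where
  "rs_kernel \<alpha> \<gamma> = (let q = CARD('x) in
     Matrix.mat q q (\<lambda>(i, j).
       if j \<le> q - 2 then \<alpha> ^ ((q - 2 - j) * (q - 1 - i))
       else if i \<le> q - 2 then 0
       else \<gamma>))"

end

(*
  The posterior distribution of the input given the output of a channel is a random probability
  vector on the field. The capacities along a random path form a bounded martingale, so they
  converge almost surely and their squared increments are summable in expectation; hence the gain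
  I(W) - I(W^(0)) tends to 0 as well. The input of W^(0) is, up to sign, the sum of all but the last
  coordinate and 1/gamma times the last one, so its entropy dominates that of the convolution of two
  posteriors. By strong convexity of t ln t, a vanishing gain forces the following: if the posterior
  charges two points differing by d with non-vanishing probability, it becomes invariant under
  translation by d/gamma. Such invariances are closed under addition, and invariance under e makes
  the posterior charge two points differing by e, so they also propagate from e to e/gamma. Thus one
  non-zero invariance yields all of them if q is prime (additive generation) or gamma is primitive
  (multiplicative generation): either the posterior degenerates to a point mass (capacity 1) or it
  becomes uniform (capacity 0).
*)

theory Submission
  imports Defs "HOL-Number_Theory.Cong" "HOL-Computational_Algebra.Polynomial"
begin

section \<open>Entropy of unnormalised distributions\<close>

text \<open>The argument must be quantitative: at finite depth no posterior is exactly a point mass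
  or exactly invariant, and only averages over the outputs converge. The quadratic functional
  \<open>corr\<close> detects both extremes. If it is small at every d \<noteq> 0, the entropy is
  small; and the loss \<open>corr w 0 - corr w d\<close> is, up to normalisation, the squared
  distance of w from its translate by d. In the gain
  \<open>corr v d * (corr w 0 - corr w (r * d))\<close> the weights v and w come from different
  coordinates of the block, hence from independent outputs, so averaging yields a product of
  averages. Thus the numbers \<open>chan_corr\<close> are all that has to be tracked along a path.
  The affine relation for the input of the first split channel holds because a polynomial of degree
  at most q - 1, summed over the field, gives minus its top coefficient. The child with index 0 need
  not lie on the path, but every child is chosen with probability 1/l, so its increment is
  controlled by the increments of the path.\<close>

definition xlnx :: "real \<Rightarrow> real" where
  "xlnx t = t * ln t"

text \<open>For positive total mass S this is S times the Shannon entropy, in nats, of w/S. The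
  homogeneous form carries the output probability as the mass, so conditional entropy becomes a
  plain sum over outputs.\<close>

definition ent :: "('x::finite \<Rightarrow> real) \<Rightarrow> real" where
  "ent w = xlnx (\<Sum>x\<in>UNIV. w x) - (\<Sum>x\<in>UNIV. xlnx (w x))"

text \<open>For the posterior distribution given one output, \<open>corr w d\<close> is the probability that two
  independent samples differ by \<open>d\<close>, weighted with the total mass of \<open>w\<close>.\<close>

definition corr :: "('x::{finite,ab_group_add} \<Rightarrow> real) \<Rightarrow> 'x \<Rightarrow> real" where
  "corr w d = (\<Sum>u\<in>UNIV. w u * w (u + d)) / (\<Sum>x\<in>UNIV. w x)"

lemma xlnx_0 [simp]: "xlnx 0 = 0"
  by (simp add: xlnx_def)

lemma xlnx_mult: "xlnx (a * b) = a * xlnx b + b * xlnx a" if "a \<ge> 0" "b \<ge> 0"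
  using that by (cases "a = 0"; cases "b = 0") (auto simp: xlnx_def ln_mult algebra_simps)

lemma ent_scale:
  assumes "c \<ge> 0" "\<And>x. w x \<ge> 0"
  shows "ent (\<lambda>x. c * w x) = c * ent w"
proof -
  have "(\<Sum>x\<in>UNIV. xlnx (c * w x)) = c * (\<Sum>x\<in>UNIV. xlnx (w x)) + (\<Sum>x\<in>UNIV. w x) * xlnx c"
    using assms by (simp add: xlnx_mult sum.distrib sum_distrib_left sum_distrib_right)
  moreover have "xlnx (\<Sum>x\<in>UNIV. c * w x) = c * xlnx (\<Sum>x\<in>UNIV. w x) + (\<Sum>x\<in>UNIV. w x) * xlnx c"
    using assms by (subst sum_distrib_left [symmetric], subst xlnx_mult) (auto simp: sum_nonneg)
  ultimately show ?thesis by (simp add: ent_def algebra_simps)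
qed

lemma ent_eq: "ent w = (\<Sum>x\<in>UNIV. w x * (ln (\<Sum>x\<in>UNIV. w x) - ln (w x)))"
  by (simp add: ent_def xlnx_def right_diff_distrib sum_subtractf sum_distrib_right)

lemma le_sum_UNIV: "w x \<le> (\<Sum>x\<in>UNIV. w x)" if "\<And>x. w x \<ge> 0" for w :: "'x::finite \<Rightarrow> real"
  using that by (intro member_le_sum) auto

lemma ent_nonneg: assumes "\<And>x. w x \<ge> 0" shows "ent w \<ge> 0"
proof -
  have "0 \<le> w x * (ln (\<Sum>x\<in>UNIV. w x) - ln (w x))" for x
  proof (cases "w x = 0")
    case False
    then have "w x > 0" using assms[of x] by simp
    then show ?thesis using le_sum_UNIV[of w x] assms by simp
  qed simp
  then show ?thesis unfolding ent_eq by (intro sum_nonneg) auto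
qed

lemma ln_card_minus_ent:
  fixes w :: "'x::finite \<Rightarrow> real"
  shows "(\<Sum>x\<in>UNIV. w x) * ln (CARD('x)) - ent w =
    (\<Sum>x\<in>UNIV. w x * (ln (CARD('x)) + ln (w x) - ln (\<Sum>x\<in>UNIV. w x)))"
  by (simp add: ent_eq sum_distrib_right sum_subtractf [symmetric] algebra_simps)

text \<open>Gibbs' inequality against the uniform distribution: \<open>ln t \<le> t - 1\<close> at t
  = S/(q * w x), where the resulting terms w x - S/q sum to zero.\<close>

lemma ent_le_ln_card:
  fixes w :: "'x::finite \<Rightarrow> real"
  assumes "\<And>x. w x \<ge> 0"
  shows "ent w \<le> (\<Sum>x\<in>UNIV. w x) * ln (CARD('x))"
proof -
  let ?S = "\<Sum>x\<in>UNIV. w x" and ?q = "real CARD('x)"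
  have q: "?q > 0" by simp
  have "w x - ?S / ?q \<le> w x * (ln ?q + ln (w x) - ln ?S)" for x
  proof (cases "w x = 0")
    case True
    then show ?thesis using assms by (auto intro!: divide_nonneg_nonneg sum_nonneg)
  next
    case False
    then have w: "w x > 0" using assms[of x] by simp
    then have S: "?S > 0" using le_sum_UNIV[of w x] assms by simp
    have "ln (?S / (?q * w x)) \<le> ?S / (?q * w x) - 1" using w S q by (intro ln_le_minus_one) auto
    then have "w x * ln (?S / (?q * w x)) \<le> w x * (?S / (?q * w x) - 1)" using w by simp
    also have "\<dots> = ?S / ?q - w x" using w by (simp add: field_simps)
    also have "ln (?S / (?q * w x)) = ln ?S - ln ?q - ln (w x)"
      using w S q by (simp add: ln_div ln_mult)
    finally show ?thesis by (simp add: algebra_simps)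
  qed
  then have "(\<Sum>x\<in>UNIV. w x - ?S / ?q) \<le> (\<Sum>x\<in>UNIV. w x * (ln ?q + ln (w x) - ln ?S))"
    by (intro sum_mono) auto
  then show ?thesis unfolding ln_card_minus_ent [symmetric] by (simp add: sum_subtractf)
qed

text \<open>Relative entropy is at most chi-squared divergence. The right-hand side is S times the
  chi-squared divergence of w/S from the uniform distribution, so a collision probability near 1/q
  forces the entropy close to its maximum.\<close>

lemma ent_ge_corr:
  fixes w :: "'x::{finite,ab_group_add} \<Rightarrow> real"
  assumes "\<And>x. w x \<ge> 0"
  shows "(\<Sum>x\<in>UNIV. w x) * ln (CARD('x)) - ent w \<le> CARD('x) * corr w 0 - (\<Sum>x\<in>UNIV. w x)"
proof -
  let ?S = "\<Sum>x\<in>UNIV. w x" and ?q = "real CARD('x)"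
  have q: "?q > 0" by simp
  have "w x * (ln ?q + ln (w x) - ln ?S) \<le> ?q * (w x * w x / ?S) - w x" for x
  proof (cases "w x = 0")
    case False
    then have w: "w x > 0" using assms[of x] by simp
    then have S: "?S > 0" using le_sum_UNIV[of w x] assms by simp
    have "ln (?q * w x / ?S) \<le> ?q * w x / ?S - 1" using w S q by (intro ln_le_minus_one) auto
    then have "w x * ln (?q * w x / ?S) \<le> w x * (?q * w x / ?S - 1)" using w by simp
    also have "ln (?q * w x / ?S) = ln ?q + ln (w x) - ln ?S"
      using w S q by (simp add: ln_div ln_mult)
    finally show ?thesis by (simp add: algebra_simps)
  qed simp
  then have "(\<Sum>x\<in>UNIV. w x * (ln ?q + ln (w x) - ln ?S)) \<le> (\<Sum>x\<in>UNIV. ?q * (w x * w x / ?S) - w x)"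
    by (intro sum_mono) auto
  also have "\<dots> = ?q * corr w 0 - ?S"
    by (simp add: sum_subtractf sum_distrib_left corr_def sum_divide_distrib)
  finally show ?thesis unfolding ln_card_minus_ent .
qed

text \<open>The slope of - p ln p at 0 is infinite, so no multiple of p(1 - p) bounds it; the
  additive \<eta> absorbs this. With s = sqrt p the left side is at most 2s(1 - s), then the
  arithmetic-geometric mean inequality and (s(1 - s))^2 \<le> p(1 - p) apply. Linearity in p(1 - p)
  is what survives summation over outputs.\<close>

lemma neg_xlnx_le:
  assumes "0 \<le> p" "p \<le> 1" "\<eta> > 0"
  shows "- xlnx p \<le> \<eta> + p * (1 - p) / \<eta>"
proof (cases "p = 0")
  case False
  define s where "s = sqrt p"
  have s: "s > 0" "s \<le> 1" "p = s\<^sup>2" using assms False by (auto simp: s_def)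
  have "ln (1 / s) \<le> 1 / s - 1" using s by (intro ln_le_minus_one) auto
  then have "2 * s\<^sup>2 * ln (1 / s) \<le> 2 * s\<^sup>2 * (1 / s - 1)" using s by simp
  moreover have "ln p = 2 * ln s" using s by (simp add: ln_realpow)
  ultimately have 1: "- xlnx p \<le> 2 * s * (1 - s)"
    using s by (simp add: xlnx_def ln_div power2_eq_square algebra_simps)
  have "2 * (s * (1 - s)) * \<eta> \<le> \<eta>\<^sup>2 + (s * (1 - s))\<^sup>2"
    using sum_squares_bound[of "s * (1 - s)" \<eta>] by (simp add: algebra_simps)
  also have "(s * (1 - s))\<^sup>2 = p * ((1 - s) * (1 - s))" by (simp add: s power2_eq_square)
  also have "\<dots> \<le> p * ((1 - s) * (1 + s))"
    using s by (intro mult_left_mono) (auto simp: assms)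
  also have "\<dots> = p * (1 - p)" by (simp add: s power2_eq_square algebra_simps)
  finally have "2 * (s * (1 - s)) \<le> (\<eta>\<^sup>2 + p * (1 - p)) / \<eta>"
    using assms by (simp add: pos_le_divide_eq)
  also have "\<dots> = \<eta> + p * (1 - p) / \<eta>" using assms by (simp add: power2_eq_square field_simps)
  finally show ?thesis using 1 by simp
qed (use assms in auto)

lemma sum_corr:
  fixes w :: "'x::{finite,ab_group_add} \<Rightarrow> real"
  shows "(\<Sum>d\<in>UNIV. corr w d) = (\<Sum>x\<in>UNIV. w x)"
proof -
  have *: "(\<Sum>d\<in>UNIV. w (u + d)) = (\<Sum>x\<in>UNIV. w x)" for u
    by (rule sum.reindex_bij_witness[of _ "\<lambda>x. x - u" "\<lambda>d. u + d"]) auto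
  have "(\<Sum>d\<in>UNIV. corr w d) = (\<Sum>d\<in>UNIV. \<Sum>u\<in>UNIV. w u * w (u + d)) / (\<Sum>x\<in>UNIV. w x)"
    by (simp add: corr_def sum_divide_distrib)
  also have "(\<Sum>d\<in>UNIV. \<Sum>u\<in>UNIV. w u * w (u + d)) = (\<Sum>u\<in>UNIV. w u * (\<Sum>x\<in>UNIV. w x))"
    by (subst sum.swap) (simp add: sum_distrib_left [symmetric] *)
  finally show ?thesis by (simp add: sum_distrib_right [symmetric])
qed

lemma corr_nonneg: "corr w d \<ge> 0" if "\<And>x. w x \<ge> 0"
  unfolding corr_def using that by (intro divide_nonneg_nonneg sum_nonneg mult_nonneg_nonneg) auto

lemma corr_le_sum: "corr w d \<le> (\<Sum>x\<in>UNIV. w x)" if "\<And>x. w x \<ge> 0"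
proof -
  have "corr w d \<le> (\<Sum>d\<in>UNIV. corr w d)" using that by (intro member_le_sum corr_nonneg) auto
  then show ?thesis by (simp add: sum_corr)
qed

text \<open>Apply \<open>neg_xlnx_le\<close> to each w x / S: the terms p(1 - p) add up to the
  probability that two independent samples differ, which is the total correlation at non-zero
  shifts. The parameter \<eta> stays free so that it can tend to 0 after the correlations
  have.\<close>

lemma ent_le_corr:
  fixes w :: "'x::{finite,ab_group_add} \<Rightarrow> real" and \<eta> :: real
  assumes w: "\<And>x. w x \<ge> 0" and \<eta>: "\<eta> > 0"
  shows "ent w \<le> CARD('x) * \<eta> * (\<Sum>x\<in>UNIV. w x) + (\<Sum>d\<in>UNIV-{0}. corr w d) / \<eta>"
proof -
  define S where "S = (\<Sum>x\<in>UNIV. w x)"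
  have "w x * (ln S - ln (w x)) \<le> \<eta> * S + (w x - w x * w x / S) / \<eta>" for x
  proof (cases "w x = 0")
    case True
    then show ?thesis using assms by (auto simp: S_def intro!: mult_nonneg_nonneg sum_nonneg)
  next
    case False
    then have wx: "w x > 0" using w[of x] by simp
    then have S: "S > 0" "w x \<le> S" using le_sum_UNIV[of w x] w by (auto simp: S_def)
    have "S * (- xlnx (w x / S)) \<le> S * (\<eta> + (w x / S) * (1 - w x / S) / \<eta>)"
      using wx S \<eta> by (intro mult_left_mono neg_xlnx_le) auto
    also have "S * (- xlnx (w x / S)) = w x * (ln S - ln (w x))"
      using wx S by (simp add: xlnx_def ln_div algebra_simps)
    also have "S * (\<eta> + (w x / S) * (1 - w x / S) / \<eta>) = \<eta> * S + (w x - w x * w x / S) / \<eta>"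
      using S \<eta> by (simp add: field_simps)
    finally show ?thesis .
  qed
  then have "ent w \<le> (\<Sum>x\<in>UNIV. \<eta> * S + (w x - w x * w x / S) / \<eta>)"
    unfolding ent_eq S_def [symmetric] by (intro sum_mono) auto
  also have "\<dots> = CARD('x) * \<eta> * S + (S - corr w 0) / \<eta>"
    by (simp add: sum.distrib sum_divide_distrib [symmetric] sum_subtractf corr_def S_def)
  also have "S - corr w 0 = (\<Sum>d\<in>UNIV-{0}. corr w d)"
    using sum_corr[of w] by (simp add: S_def sum_diff1)
  finally show ?thesis by (simp add: S_def)
qed

text \<open>Expand the square; the translate has the same sum of squares as w. The loss of
  correlation thereby measures how far w is from being invariant under d.\<close>

lemma corr_diff:
  fixes w :: "'x::{finite,ab_group_add} \<Rightarrow> real"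
  shows "corr w 0 - corr w d = (\<Sum>u\<in>UNIV. (w u - w (u + d))\<^sup>2) / (2 * (\<Sum>x\<in>UNIV. w x))"
proof -
  have *: "(\<Sum>u\<in>UNIV. w (u + d) * w (u + d)) = (\<Sum>u\<in>UNIV. w u * w u)"
    by (rule sum.reindex_bij_witness[of _ "\<lambda>x. x - d" "\<lambda>x. x + d"]) auto
  have "(\<Sum>u\<in>UNIV. (w u - w (u + d))\<^sup>2) =
      (\<Sum>u\<in>UNIV. w u * w u + w (u + d) * w (u + d) - 2 * (w u * w (u + d)))"
    by (simp add: power2_eq_square algebra_simps)
  also have "\<dots> = 2 * ((\<Sum>u\<in>UNIV. w u * w u) - (\<Sum>u\<in>UNIV. w u * w (u + d)))"
    by (simp add: sum.distrib sum_subtractf * sum_distrib_left [symmetric])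
  finally have "(\<Sum>u\<in>UNIV. (w u - w (u + d))\<^sup>2) =
      2 * ((\<Sum>u\<in>UNIV. w u * w u) - (\<Sum>u\<in>UNIV. w u * w (u + d)))" .
  then show ?thesis by (simp add: corr_def diff_divide_distrib)
qed

lemma corr_le_corr_0:
  assumes "\<And>x. w x \<ge> 0"
  shows "corr w d \<le> corr w 0"
proof -
  have "corr w 0 - corr w d \<ge> 0" unfolding corr_diff
    using assms by (intro divide_nonneg_nonneg sum_nonneg mult_nonneg_nonneg) auto
  then show ?thesis by simp
qed

text \<open>Triangle inequality through the intermediate translate by d, with the factor 2 from
  squaring. It is the approximate form of the closure of periods under addition.\<close>

lemma corr_diff_add:
  fixes w :: "'x::{finite,ab_group_add} \<Rightarrow> real"
  assumes "\<And>x. w x \<ge> 0"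
  shows "corr w 0 - corr w (d + e) \<le> 2 * (corr w 0 - corr w d) + 2 * (corr w 0 - corr w e)"
proof -
  have *: "(\<Sum>u\<in>UNIV. (w (u + d) - w (u + d + e))\<^sup>2) = (\<Sum>u\<in>UNIV. (w u - w (u + e))\<^sup>2)"
    by (rule sum.reindex_bij_witness[of _ "\<lambda>x. x - d" "\<lambda>x. x + d"]) (auto simp: algebra_simps)
  have sq: "(a - c)\<^sup>2 \<le> 2 * (a - b)\<^sup>2 + 2 * (b - c)\<^sup>2" for a b c :: real
    using zero_le_power2[of "(a - b) - (b - c)"] by (simp add: power2_eq_square algebra_simps)
  have "(\<Sum>u\<in>UNIV. (w u - w (u + (d + e)))\<^sup>2) \<le>
      (\<Sum>u\<in>UNIV. 2 * (w u - w (u + d))\<^sup>2 + 2 * (w (u + d) - w (u + d + e))\<^sup>2)"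
    by (intro sum_mono) (use sq in \<open>auto simp: add.assoc\<close>)
  also have "\<dots> = 2 * (\<Sum>u\<in>UNIV. (w u - w (u + d))\<^sup>2) + 2 * (\<Sum>u\<in>UNIV. (w u - w (u + e))\<^sup>2)"
    by (simp add: sum.distrib sum_distrib_left [symmetric] *)
  finally have "(\<Sum>u\<in>UNIV. (w u - w (u + (d + e)))\<^sup>2) / (2 * (\<Sum>x\<in>UNIV. w x)) \<le>
     (2 * (\<Sum>u\<in>UNIV. (w u - w (u + d))\<^sup>2) + 2 * (\<Sum>u\<in>UNIV. (w u - w (u + e))\<^sup>2)) / (2 * (\<Sum>x\<in>UNIV. w x))"
    using assms by (intro divide_right_mono) (auto simp: sum_nonneg)
  then show ?thesis unfolding corr_diff by (simp add: add_divide_distrib)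
qed

section \<open>The entropy gain of a convolution\<close>

text \<open>Passing to square roots a, b of v, m avoids a Taylor expansion, which would fail at v =
  0. The gap between \<open>xlnx\<close> and its tangent at m is at least (a - b)^2, and (v - m)^2 =
  (a - b)^2 (a + b)^2 with (a + b)^2 \<le> 4S.\<close>

lemma xlnx_strongly_convex:
  assumes "0 \<le> v" "v \<le> S" "0 < m" "m \<le> S"
  shows "xlnx m + (ln m + 1) * (v - m) + (v - m)\<^sup>2 / (4 * S) \<le> xlnx v"
proof -
  define a b where "a = sqrt v" and "b = sqrt m"
  have ab: "a \<ge> 0" "b > 0" "v = a\<^sup>2" "m = b\<^sup>2" using assms by (auto simp: a_def b_def)
  have "(a + b)\<^sup>2 \<le> 2 * a\<^sup>2 + 2 * b\<^sup>2"
    using zero_le_power2[of "a - b"] by (simp add: power2_eq_square algebra_simps)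
  also have "\<dots> \<le> 4 * S" using assms ab by simp
  finally have "(a - b)\<^sup>2 * (a + b)\<^sup>2 \<le> (a - b)\<^sup>2 * (4 * S)" by (intro mult_left_mono) auto
  also have "(a - b)\<^sup>2 * (a + b)\<^sup>2 = (v - m)\<^sup>2" by (simp add: ab power2_eq_square algebra_simps)
  finally have 1: "(v - m)\<^sup>2 / (4 * S) \<le> (a - b)\<^sup>2" using assms by (simp add: pos_divide_le_eq)
  have "(a - b)\<^sup>2 \<le> xlnx v - xlnx m - (ln m + 1) * (v - m)"
  proof (cases "a = 0")
    case True
    then show ?thesis using ab by (simp add: xlnx_def algebra_simps)
  next
    case False
    then have a: "a > 0" using ab by simp
    have "ln (b / a) \<le> b / a - 1" using a ab by (intro ln_le_minus_one) auto
    then have "2 * a\<^sup>2 * ln (b / a) \<le> 2 * a\<^sup>2 * (b / a - 1)" using a by simp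
    also have "\<dots> = 2 * a * b - 2 * a\<^sup>2" using a by (simp add: field_simps power2_eq_square)
    also have "2 * a\<^sup>2 * ln (b / a) = v * ln m - v * ln v"
      using a ab by (simp add: ln_div ln_realpow algebra_simps)
    finally show ?thesis by (simp add: xlnx_def ab power2_eq_square algebra_simps)
  qed
  then show ?thesis using 1 by simp
qed

text \<open>Jensen's inequality with a variance term: average the tangent bound at the mean m, where
  the linear part cancels.\<close>

lemma xlnx_jensen_gap:
  assumes T: "finite T" "\<And>t. t \<in> T \<Longrightarrow> p t \<ge> 0" and v: "\<And>t. t \<in> T \<Longrightarrow> 0 \<le> v t \<and> v t \<le> S"
    and P: "P = (\<Sum>t\<in>T. p t)" "P > 0" and m: "m = (\<Sum>t\<in>T. p t * v t) / P"
  shows "P * xlnx m + (\<Sum>t\<in>T. p t * (v t - m)\<^sup>2) / (4 * S) \<le> (\<Sum>t\<in>T. p t * xlnx (v t))"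
proof -
  have Pm: "(\<Sum>t\<in>T. p t * v t) = P * m" using P m by simp
  have mean: "(\<Sum>t\<in>T. p t * (v t - m)) = 0"
    using Pm P by (simp add: right_diff_distrib sum_subtractf sum_distrib_right [symmetric])
  show ?thesis
  \<comment> \<open>The tangent at m exists only for m > 0. If m = 0, every \<open>v t\<close> of
    positive weight is 0 and both sides vanish.\<close>
  proof (cases "m = 0")
    case True
    then have "\<forall>t\<in>T. p t * v t = 0"
      using Pm T v by (intro sum_nonneg_eq_0_iff [THEN iffD1]) auto
    then have "\<forall>t\<in>T. p t = 0 \<or> v t = 0" by simp
    then have "(\<Sum>t\<in>T. p t * (v t - m)\<^sup>2) = 0" "(\<Sum>t\<in>T. p t * xlnx (v t)) = 0"
      by (auto intro!: sum.neutral simp: True)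
    then show ?thesis by (simp add: True)
  next
    case False
    have "m \<ge> 0" unfolding m using T v P by (intro divide_nonneg_nonneg sum_nonneg) auto
    then have m0: "m > 0" using False by simp
    have "P * m \<le> (\<Sum>t\<in>T. p t * S)"
      unfolding Pm [symmetric] using T v by (intro sum_mono mult_left_mono) auto
    also have "\<dots> = P * S" by (simp add: P sum_distrib_right)
    finally have mS: "m \<le> S" using P by simp
    have "(\<Sum>t\<in>T. p t * (xlnx m + (ln m + 1) * (v t - m) + (v t - m)\<^sup>2 / (4 * S))) \<le>
      (\<Sum>t\<in>T. p t * xlnx (v t))"
      using T v m0 mS by (intro sum_mono mult_left_mono xlnx_strongly_convex) auto
    also have "(\<Sum>t\<in>T. p t * (xlnx m + (ln m + 1) * (v t - m) + (v t - m)\<^sup>2 / (4 * S))) =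
      P * xlnx m + (ln m + 1) * (\<Sum>t\<in>T. p t * (v t - m)) + (\<Sum>t\<in>T. p t * (v t - m)\<^sup>2) / (4 * S)"
      unfolding P sum_distrib_left sum_distrib_right sum_divide_distrib sum.distrib [symmetric]
      by (intro sum.cong) (auto simp: algebra_simps)
    finally show ?thesis by (simp add: mean)
  qed
qed

text \<open>F mixes reflected translates of w, each of which has the entropy of w. Jensen's
  inequality is applied separately at every point u, so the excess entropy is at least the total
  spread of the translates around their mean.\<close>

lemma ent_mixture_gap:
  fixes w :: "'x::{finite,ab_group_add} \<Rightarrow> real"
  assumes w: "\<And>x. w x \<ge> 0" and T: "finite T" "\<And>t. t \<in> T \<Longrightarrow> p t \<ge> 0"
    and P: "P = (\<Sum>t\<in>T. p t)" "P > 0"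
    and F: "\<And>u. F u = (\<Sum>t\<in>T. p t * w (e t - u))"
  shows "P * ent w + (\<Sum>u\<in>UNIV. \<Sum>t\<in>T. p t * (w (e t - u) - F u / P)\<^sup>2) / (4 * (\<Sum>x\<in>UNIV. w x))
    \<le> ent F"
proof -
  define S where "S = (\<Sum>x\<in>UNIV. w x)"
  have shift: "(\<Sum>u\<in>UNIV. g (w (z - u))) = (\<Sum>u\<in>UNIV. g (w u))" for g :: "real \<Rightarrow> real" and z
    by (rule sum.reindex_bij_witness[of _ "\<lambda>x. z - x" "\<lambda>x. z - x"]) auto
  have FS: "(\<Sum>u\<in>UNIV. F u) = P * S"
    unfolding F using shift[of "\<lambda>x. x"]
    by (subst sum.swap) (simp add: sum_distrib_left [symmetric] sum_distrib_right [symmetric] P S_def)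
  have F0: "F u \<ge> 0" for u unfolding F using T w by (intro sum_nonneg) auto
  have "P * (xlnx S - (\<Sum>u\<in>UNIV. xlnx (F u / P))) = P * ent (\<lambda>u. F u / P)"
    using P by (simp add: ent_def sum_divide_distrib [symmetric] FS)
  also have "\<dots> = ent (\<lambda>u. P * (F u / P))"
    using P F0 by (subst ent_scale) auto
  also have "\<dots> = ent F" using P by simp
  finally have entF: "ent F = P * xlnx S - (\<Sum>u\<in>UNIV. P * xlnx (F u / P))"
    by (simp add: algebra_simps sum_distrib_left)
  have "(\<Sum>u\<in>UNIV. P * xlnx (F u / P) + (\<Sum>t\<in>T. p t * (w (e t - u) - F u / P)\<^sup>2) / (4 * S)) \<le>
     (\<Sum>u\<in>UNIV. \<Sum>t\<in>T. p t * xlnx (w (e t - u)))"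
    using T w P F by (intro sum_mono xlnx_jensen_gap) (auto simp: S_def intro!: le_sum_UNIV)
  also have "\<dots> = P * (\<Sum>u\<in>UNIV. xlnx (w u))"
    by (subst sum.swap) (simp add: sum_distrib_left [symmetric] shift P sum_distrib_right)
  finally show ?thesis
    unfolding entF by (simp add: ent_def S_def [symmetric] sum.distrib sum_divide_distrib algebra_simps)
qed

text \<open>Two points far apart cannot both be close to m. The difference of the two sides, with s
  = a + b and after multiplication by it, is the square of a(x - m) + b(y - m); m itself drops out
  of the bound.\<close>

lemma weighted_square_sum_ge:
  fixes a b x y m s :: real
  assumes "a \<ge> 0" "b \<ge> 0" "a + b \<le> s"
  shows "a * b / s * (x - y)\<^sup>2 \<le> a * (x - m)\<^sup>2 + b * (y - m)\<^sup>2"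
proof (cases "s = 0")
  case True
  then show ?thesis using assms by simp
next
  case False
  then have s: "s > 0" using assms by simp
  have "0 \<le> (a * (x - m) + b * (y - m))\<^sup>2" by simp
  also have "\<dots> = (a + b) * (a * (x - m)\<^sup>2 + b * (y - m)\<^sup>2) - a * b * (x - y)\<^sup>2"
    by (simp add: power2_eq_square algebra_simps)
  finally have "a * b * (x - y)\<^sup>2 \<le> (a + b) * (a * (x - m)\<^sup>2 + b * (y - m)\<^sup>2)" by simp
  also have "\<dots> \<le> s * (a * (x - m)\<^sup>2 + b * (y - m)\<^sup>2)"
    using assms by (intro mult_right_mono) auto
  finally show ?thesis using s by (simp add: field_simps)
qed

text \<open>View F as a mixture over pairs (t, k). The components k and k + d are translates of w
  that differ by r * d, so the spread around the mean is large if v charges such pairs and w is not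
  invariant under r * d. Averaging over the q choices of k costs a factor q; the 4S of the Jensen
  gap and the 2S of \<open>corr_diff\<close> leave the factor 2.\<close>

lemma ent_convolution_gap:
  fixes w v :: "'x::{finite,field} \<Rightarrow> real"
  assumes w: "\<And>x. w x \<ge> 0" and v: "\<And>x. v x \<ge> 0" and T: "finite T" "\<And>t. t \<in> T \<Longrightarrow> p t \<ge> 0"
    and F: "\<And>u. F u = (\<Sum>t\<in>T. \<Sum>k\<in>UNIV. p t * v k * w (e t - r * k - u))"
    and d: "d \<noteq> 0"
  shows "(\<Sum>t\<in>T. p t) * ((\<Sum>x\<in>UNIV. v x) * ent w
      + corr v d * (corr w 0 - corr w (r * d)) / (2 * CARD('x))) \<le> ent F"
proof -
  define P S V where "P = (\<Sum>t\<in>T. p t)" and "S = (\<Sum>x\<in>UNIV. w x)" and "V = (\<Sum>x\<in>UNIV. v x)"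
  have nn: "P \<ge> 0" "S \<ge> 0" "V \<ge> 0" using w v T by (auto simp: P_def S_def V_def sum_nonneg)
  have F0: "F u \<ge> 0" for u unfolding F using T w v by (intro sum_nonneg) auto
  show ?thesis
  proof (cases "P * V = 0")
    case True
    \<comment> \<open>If v has mass zero, \<open>corr v d\<close> is a division by zero and hence 0,
      which makes the bound trivial.\<close>
    have "P = 0 \<or> (V = 0 \<and> corr v d = 0)"
      using True by (auto simp: corr_def V_def)
    then have "P * (V * ent w + corr v d * (corr w 0 - corr w (r * d)) / (2 * CARD('x))) = 0"
      by auto
    then show ?thesis using ent_nonneg[of F, OF F0] unfolding P_def V_def by linarith
  next
    case False
    then have pos: "P * V > 0" using nn by (simp add: less_le)
    let ?q = "real CARD('x)"
    define D where "D = (\<Sum>u\<in>UNIV. (w u - w (u + r * d))\<^sup>2)"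
    define m where "m u = F u / (P * V)" for u
    have F': "F u = (\<Sum>(t,k)\<in>T\<times>UNIV. p t * v k * w ((case (t,k) of (t,k) \<Rightarrow> e t - r * k) - u))" for u
      by (simp add: F sum.cartesian_product)
    have PV: "P * V = (\<Sum>(t,k)\<in>T\<times>UNIV. p t * v k)"
      by (simp add: P_def V_def sum_product sum.cartesian_product)
    have 1: "P * V * ent w + (\<Sum>u\<in>UNIV. \<Sum>(t,k)\<in>T\<times>UNIV. p t * v k * (w (e t - r * k - u) - m u)\<^sup>2) / (4 * S)
      \<le> ent F"
      using ent_mixture_gap[of w "T\<times>UNIV" "\<lambda>(t,k). p t * v k" "P * V" F "\<lambda>(t,k). e t - r * k"]
        w v T pos PV F by (auto simp: S_def m_def case_prod_beta' sum.cartesian_product)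
    have shift: "(\<Sum>u\<in>UNIV. (w (z - u) - w (z - r * d - u))\<^sup>2) = D" for z
      unfolding D_def
      by (rule sum.reindex_bij_witness[of _ "\<lambda>x. z - r * d - x" "\<lambda>x. z - r * d - x"])
        (auto simp: algebra_simps power2_commute)
    have 2: "P * (v k * v (k + d) / V) * D \<le>
        (\<Sum>u\<in>UNIV. \<Sum>(t,k)\<in>T\<times>UNIV. p t * v k * (w (e t - r * k - u) - m u)\<^sup>2)" (is "_ \<le> ?R") for k
    proof -
      have kd: "k \<noteq> k + d" using d by simp
      have "v k + v (k + d) = (\<Sum>x\<in>{k, k + d}. v x)" using kd by simp
      also have "\<dots> \<le> V" unfolding V_def using v by (intro sum_mono2) auto
      finally have vk: "v k + v (k + d) \<le> V" .
      have "P * (v k * v (k + d) / V) * D =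
         (\<Sum>t\<in>T. p t * (v k * v (k + d) / V * (\<Sum>u\<in>UNIV. (w (e t - r * k - u) - w (e t - r * k - r * d - u))\<^sup>2)))"
        unfolding shift P_def sum_distrib_right by (intro sum.cong) (auto simp: mult.assoc)
      also have "\<dots> = (\<Sum>u\<in>UNIV. \<Sum>t\<in>T. p t * (v k * v (k + d) / V *
          (w (e t - r * k - u) - w (e t - r * (k + d) - u))\<^sup>2))"
        by (subst sum.swap) (simp add: sum_distrib_left ring_distribs diff_diff_eq)
      also have "\<dots> \<le> (\<Sum>u\<in>UNIV. \<Sum>t\<in>T. p t * (v k * (w (e t - r * k - u) - m u)\<^sup>2
          + v (k + d) * (w (e t - r * (k + d) - u) - m u)\<^sup>2))"
        using T v vk by (intro sum_mono mult_left_mono weighted_square_sum_ge) auto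
      also have "\<dots> = (\<Sum>u\<in>UNIV. \<Sum>t\<in>T. \<Sum>k\<in>{k, k + d}. p t * v k * (w (e t - r * k - u) - m u)\<^sup>2)"
        using kd by (simp add: algebra_simps)
      also have "\<dots> \<le> (\<Sum>u\<in>UNIV. \<Sum>t\<in>T. \<Sum>k\<in>UNIV. p t * v k * (w (e t - r * k - u) - m u)\<^sup>2)"
        using T v by (intro sum_mono sum_mono2) auto
      finally show ?thesis by (simp add: sum.cartesian_product)
    qed
    have "P * corr v d * D = (\<Sum>k\<in>UNIV. P * (v k * v (k + d) / V) * D)"
      by (simp add: corr_def V_def sum_distrib_left sum_distrib_right sum_divide_distrib)
    also have "\<dots> \<le> (\<Sum>k\<in>(UNIV :: 'x set). ?R)" by (intro sum_mono 2)
    also have "\<dots> = ?q * ?R" by simp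
    finally have "P * corr v d * D / ?q \<le> ?R" by (simp add: field_simps)
    then have "P * corr v d * D / ?q / (4 * S) \<le> ?R / (4 * S)" using nn by (intro divide_right_mono) auto
    moreover have "corr w 0 - corr w (r * d) = D / (2 * S)" by (simp add: corr_diff D_def S_def)
    ultimately show ?thesis using 1 by (simp add: P_def [symmetric] V_def [symmetric] algebra_simps)
  qed
qed

section \<open>Sums over lists of fixed length\<close>

lemma has_sum_sum_finite:
  fixes f :: "'a \<Rightarrow> 'b \<Rightarrow> real"
  assumes "finite A" "\<And>a. a \<in> A \<Longrightarrow> (f a has_sum s a) B"
  shows "((\<lambda>x. \<Sum>a\<in>A. f a x) has_sum (\<Sum>a\<in>A. s a)) B"
  using assms by (induction rule: finite_induct) (auto intro!: has_sum_add)

lemma has_sum_product_nonneg: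
  fixes f :: "'a \<Rightarrow> real" and g :: "'b \<Rightarrow> real"
  assumes f: "(f has_sum a) A" "\<And>x. x \<in> A \<Longrightarrow> f x \<ge> 0"
    and g: "(g has_sum b) B" "\<And>x. x \<in> B \<Longrightarrow> g x \<ge> 0"
  shows "((\<lambda>(x, y). f x * g y) has_sum (a * b)) (A \<times> B)"
proof -
  have 1: "((\<lambda>y. case (x, y) of (x, y) \<Rightarrow> f x * g y) has_sum (f x * b)) B" for x
    using g by (auto intro: has_sum_cmult_right)
  have 2: "((\<lambda>x. f x * b) has_sum (a * b)) A" using f by (intro has_sum_cmult_left)
  show ?thesis
    by (rule has_sum_SigmaI[OF 1 2 summable_on_SigmaI[OF 1]])
      (use f g 2 in \<open>auto intro: has_sum_imp_summable\<close>)
qed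

lemma bij_betw_Cons_lists:
  "bij_betw (\<lambda>(x, xs). x # xs) (UNIV \<times> {xs. length xs = n}) {xs. length xs = Suc n}"
  by (rule bij_betwI[where g = "\<lambda>xs. (hd xs, tl xs)"]) (auto simp: length_Suc_conv)

lemma bij_betw_snoc_lists:
  "bij_betw (\<lambda>(xs, x). xs @ [x]) ({xs. length xs = n} \<times> UNIV) {xs. length xs = Suc n}"
  by (rule bij_betwI[where g = "\<lambda>xs. (butlast xs, last xs)"])
    (auto simp: length_Suc_conv_rev)

lemma sum_lists_Cons:
  fixes g :: "'x::finite list \<Rightarrow> 'b::comm_monoid_add"
  shows "(\<Sum>xs | length xs = Suc n. g xs) = (\<Sum>x\<in>UNIV. \<Sum>xs | length xs = n. g (x # xs))"
  using sum.reindex_bij_betw[OF bij_betw_Cons_lists, of g n]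
  by (simp add: case_prod_beta' sum.cartesian_product)

lemma sum_lists_snoc:
  fixes g :: "'x::finite list \<Rightarrow> 'b::comm_monoid_add"
  shows "(\<Sum>xs | length xs = Suc n. g xs) = (\<Sum>xs | length xs = n. \<Sum>x\<in>UNIV. g (xs @ [x]))"
  using sum.reindex_bij_betw[OF bij_betw_snoc_lists, of g n]
  by (simp add: case_prod_beta' sum.cartesian_product)

lemma finite_lists_length_UNIV [simp]: "finite {xs :: 'x::finite list. length xs = n}"
  using finite_lists_length_eq[of "UNIV :: 'x set" n] by simp

lemma card_lists_length_UNIV [simp]: "card {xs :: 'x::finite list. length xs = n} = CARD('x) ^ n"
  using card_lists_length_eq[of "UNIV :: 'x set" n] by simp

lemma has_sum_prod_lists:
  fixes g :: "nat \<Rightarrow> 'y \<Rightarrow> real"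
  assumes "\<And>j. j < n \<Longrightarrow> (g j has_sum s j) UNIV" "\<And>j y. j < n \<Longrightarrow> g j y \<ge> 0"
  shows "((\<lambda>ys. \<Prod>j<n. g j (ys ! j)) has_sum (\<Prod>j<n. s j)) {ys. length ys = n}"
  using assms
proof (induction n arbitrary: g s)
  case 0
  have "((\<lambda>ys :: 'y list. 1 :: real) has_sum 1) {[]}" by (rule has_sum_finiteI) auto
  then show ?case by simp
next
  case (Suc n)
  have "((\<lambda>ys. \<Prod>j<n. g (Suc j) (ys ! j)) has_sum (\<Prod>j<n. s (Suc j))) {ys. length ys = n}"
    using Suc.prems by (intro Suc.IH) auto
  then have "((\<lambda>(y, ys). g 0 y * (\<Prod>j<n. g (Suc j) (ys ! j))) has_sum (s 0 * (\<Prod>j<n. s (Suc j))))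
     (UNIV \<times> {ys. length ys = n})"
    using Suc.prems by (intro has_sum_product_nonneg prod_nonneg) auto
  then show ?case
    by (subst has_sum_reindex_bij_betw[OF bij_betw_Cons_lists, symmetric])
      (simp add: case_prod_beta' prod.lessThan_Suc_shift del: prod.lessThan_Suc)
qed

lemma sum_prod_lists:
  fixes g :: "nat \<Rightarrow> 'x::finite \<Rightarrow> 'b::comm_semiring_1"
  shows "(\<Sum>xs | length xs = n. \<Prod>j<n. g j (xs ! j)) = (\<Prod>j<n. \<Sum>x\<in>UNIV. g j x)"
proof (induction n arbitrary: g)
  case (Suc n)
  have "(\<Sum>xs | length xs = Suc n. \<Prod>j<Suc n. g j (xs ! j)) =
      (\<Sum>x\<in>UNIV. g 0 x * (\<Sum>xs | length xs = n. \<Prod>j<n. g (Suc j) (xs ! j)))"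
    by (simp add: sum_lists_Cons prod.lessThan_Suc_shift sum_distrib_left del: prod.lessThan_Suc)
  also have "\<dots> = (\<Sum>x\<in>UNIV. g 0 x) * (\<Prod>j<n. \<Sum>x\<in>UNIV. g (Suc j) x)"
    unfolding Suc.IH[of "\<lambda>j. g (Suc j)"] by (simp add: sum_distrib_right)
  finally show ?case by (simp add: prod.lessThan_Suc_shift del: prod.lessThan_Suc)
qed simp

text \<open>By \<open>xlnx_mult\<close>, \<open>xlnx\<close> obeys the Leibniz rule, so a product
  yields one summand per factor. This is the source of the additivity of entropy over independent
  channel uses.\<close>

lemma xlnx_prod:
  assumes "finite A" "\<And>j. j \<in> A \<Longrightarrow> a j \<ge> 0"
  shows "xlnx (\<Prod>j\<in>A. a j) = (\<Sum>i\<in>A. \<Prod>j\<in>A. if j = i then xlnx (a j) else a j)"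
  using assms
proof (induction rule: finite_induct)
  case empty
  then show ?case by (simp add: xlnx_def)
next
  case (insert k A)
  have "xlnx (\<Prod>j\<in>insert k A. a j) = a k * xlnx (\<Prod>j\<in>A. a j) + (\<Prod>j\<in>A. a j) * xlnx (a k)"
    using insert by (simp add: xlnx_mult prod_nonneg)
  moreover have "(\<Prod>j\<in>A. a j) = (\<Prod>j\<in>A. if j = k then xlnx (a j) else a j)"
    using insert by (intro prod.cong) auto
  moreover have "a k * xlnx (\<Prod>j\<in>A. a j) =
      (\<Sum>i\<in>A. \<Prod>j\<in>insert k A. if j = i then xlnx (a j) else a j)"
    unfolding insert.IH[OF insert.prems, simplified] sum_distrib_left
    using insert by (intro sum.cong) auto
  ultimately show ?case using insert by simp
qed

section \<open>Conditional entropy and correlation of a channel\<close>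

text \<open>Summed over the output alphabet, \<open>ent\<close> gives the entropy of a uniform input conditioned on
  the output, up to the factor \<open>q\<close> and with natural logarithms.\<close>

definition cond_ent :: "('x::finite, 'y) channel \<Rightarrow> real" where
  "cond_ent W = (\<Sum>\<^sub>\<infinity>y. ent (\<lambda>x. W x y))"

definition chan_corr :: "('x::{finite,ab_group_add}, 'y) channel \<Rightarrow> 'x \<Rightarrow> real" where
  "chan_corr W d = (\<Sum>\<^sub>\<infinity>y. corr (\<lambda>x. W x y) d)"

lemma dmcI: "(\<And>x y. W x y \<ge> 0) \<Longrightarrow> (\<And>x. (W x has_sum 1) UNIV) \<Longrightarrow> dmc W"
  by (simp add: dmc_def)

lemma dmcD: "dmc W \<Longrightarrow> W x y \<ge> 0" "dmc W \<Longrightarrow> (W x has_sum 1) UNIV"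
  by (simp_all add: dmc_def)

lemma has_sum_out:
  fixes W :: "('x::finite, 'y) channel"
  shows "dmc W \<Longrightarrow> ((\<lambda>y. \<Sum>x\<in>UNIV. W x y) has_sum CARD('x)) UNIV"
  using has_sum_sum_finite[of "UNIV :: 'x set" W UNIV "\<lambda>_. 1"] by (simp add: dmcD)

lemma has_sum_cond_ent:
  fixes W :: "('x::finite, 'y) channel"
  assumes "dmc W"
  shows "((\<lambda>y. ent (\<lambda>x. W x y)) has_sum cond_ent W) UNIV"
proof -
  have "(\<lambda>y. (\<Sum>x\<in>UNIV. W x y) * ln (CARD('x))) summable_on UNIV"
    by (intro summable_on_cmult_left has_sum_imp_summable[OF has_sum_out] assms)
  then have "(\<lambda>y. ent (\<lambda>x. W x y)) summable_on UNIV"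
    by (rule summable_on_comparison_test)
      (auto intro!: ent_le_ln_card ent_nonneg dmcD(1)[OF assms])
  then show ?thesis by (simp add: cond_ent_def)
qed

lemma has_sum_chan_corr:
  fixes W :: "('x::{finite,ab_group_add}, 'y) channel"
  assumes "dmc W"
  shows "((\<lambda>y. corr (\<lambda>x. W x y) d) has_sum chan_corr W d) UNIV"
proof -
  have "(\<lambda>y. corr (\<lambda>x. W x y) d) summable_on UNIV"
    by (rule summable_on_comparison_test[OF has_sum_imp_summable[OF has_sum_out[OF assms]]])
      (auto intro!: corr_le_sum corr_nonneg dmcD(1)[OF assms])
  then show ?thesis by (simp add: chan_corr_def)
qed

lemma two_le_CARD: "CARD('x::{finite,zero_neq_one}) \<ge> 2"
proof -
  have "card {0, 1 :: 'x} \<le> CARD('x)" by (intro card_mono) auto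
  then show ?thesis by simp
qed

lemma ln_CARD_pos: "ln (real CARD('x::{finite,zero_neq_one})) > 0"
  using two_le_CARD[where 'x = 'x] by (intro ln_gt_zero) linarith

lemma sym_capacity_eq:
  fixes W :: "('x::{finite,zero_neq_one}, 'y) channel"
  assumes "dmc W"
  shows "sym_capacity W = 1 - cond_ent W / (CARD('x) * ln (CARD('x)))"
proof -
  define q where "q = real CARD('x)"
  define S where "S y = (\<Sum>x\<in>UNIV. W x y)" for y
  define t where "t x y = 1 / q * W x y * log q (W x y / (1 / q * S y))" for x y
  have q: "q \<ge> 2" using two_le_CARD[where 'x = 'x] by (simp add: q_def)
  have lnq: "ln q > 0" using ln_CARD_pos[where 'x = 'x] by (simp add: q_def)
  have W: "W x y \<ge> 0" for x y using assms by (rule dmcD)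
  have WS: "W x y \<le> S y" for x y unfolding S_def by (rule le_sum_UNIV) (rule W)
  have t: "t x y = (W x y * (ln q + ln (W x y) - ln (S y))) / (q * ln q)" for x y
  proof (cases "W x y = 0")
    case False
    then have "W x y > 0" "S y > 0" using W[of x y] WS[of x y] by auto
    then show ?thesis using q lnq by (simp add: t_def log_def ln_div ln_mult field_simps)
  qed (simp add: t_def)
  have bound: "\<bar>W x y * (ln (W x y) - ln (S y))\<bar> \<le> S y" for x y
  proof (cases "W x y = 0")
    case True
    then show ?thesis using W by (auto simp: S_def intro: sum_nonneg)
  next
    case False
    then have w: "W x y > 0" using W[of x y] by simp
    then have S: "S y > 0" "W x y \<le> S y" using WS[of x y] by auto
    have "ln (S y / W x y) \<le> S y / W x y - 1" using w S by (intro ln_le_minus_one) auto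
    then have "W x y * ln (S y / W x y) \<le> W x y * (S y / W x y - 1)" using w by simp
    also have "\<dots> = S y - W x y" using w by (simp add: field_simps)
    finally have "W x y * (ln (S y) - ln (W x y)) \<le> S y" using w S by (simp add: ln_div)
    moreover have "W x y * (ln (S y) - ln (W x y)) \<ge> 0" using w S by simp
    ultimately show ?thesis by (simp add: abs_if algebra_simps)
  qed
  have S_sum: "(S has_sum q) UNIV" unfolding S_def q_def by (rule has_sum_out) fact
  have "(\<lambda>y. W x y * (ln (W x y) - ln (S y))) summable_on UNIV" for x
    by (rule abs_summable_summable, rule summable_on_comparison_test[OF has_sum_imp_summable[OF S_sum]])
      (use bound in auto)
  then have "(\<lambda>y. (W x y * (ln (W x y) - ln (S y)) + W x y * ln q) * (1 / (q * ln q))) summable_on UNIV" for x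
    using assms
    by (intro summable_on_cmult_left summable_on_add) (auto intro!: has_sum_imp_summable dmcD)
  moreover have "t x y = (W x y * (ln (W x y) - ln (S y)) + W x y * ln q) * (1 / (q * ln q))" for x y
    using q lnq by (simp add: t field_simps)
  ultimately have "t x summable_on UNIV" for x by presburger
  then have "((\<lambda>y. \<Sum>x\<in>UNIV. t x y) has_sum (\<Sum>x\<in>UNIV. infsum (t x) UNIV)) UNIV"
    by (intro has_sum_sum_finite) auto
  moreover have "(\<Sum>x\<in>UNIV. t x y) = (S y * ln q - ent (\<lambda>x. W x y)) / (q * ln q)" for y
    unfolding t sum_divide_distrib [symmetric] S_def q_def ln_card_minus_ent ..
  moreover have "((\<lambda>y. (S y * ln q - ent (\<lambda>x. W x y)) * (1 / (q * ln q))) has_sum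
      ((q * ln q - cond_ent W) * (1 / (q * ln q)))) UNIV"
    unfolding diff_conv_add_uminus
    by (intro has_sum_cmult_left has_sum_add has_sum_uminus[THEN iffD2]) (simp_all add: S_sum has_sum_cond_ent assms)
  ultimately have "(\<Sum>x\<in>UNIV. infsum (t x) UNIV) = (q * ln q - cond_ent W) * (1 / (q * ln q))"
    by (simp add: has_sum_unique)
  moreover have "sym_capacity W = (\<Sum>x\<in>UNIV. infsum (t x) UNIV)"
    unfolding sym_capacity_def t_def[abs_def] q_def S_def ..
  ultimately show ?thesis using q lnq by (simp add: q_def[symmetric] field_simps)
qed

lemma cond_ent_nonneg: "dmc W \<Longrightarrow> cond_ent W \<ge> 0"
  by (rule has_sum_nonneg[OF has_sum_cond_ent]) (simp_all add: ent_nonneg dmcD)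

lemma cond_ent_le:
  fixes W :: "('x::finite, 'y) channel"
  assumes "dmc W"
  shows "cond_ent W \<le> CARD('x) * ln (CARD('x))"
  by (rule has_sum_mono[OF has_sum_cond_ent[OF assms(1)] has_sum_cmult_left[OF has_sum_out[OF assms(1)]]])
    (simp_all add: ent_le_ln_card dmcD assms)

lemma sym_capacity_bounds:
  fixes W :: "('x::{finite,zero_neq_one}, 'y) channel"
  assumes "dmc W"
  shows "0 \<le> sym_capacity W" "sym_capacity W \<le> 1"
  using cond_ent_nonneg[OF assms] cond_ent_le[OF assms] ln_CARD_pos[where 'x = 'x]
  by (auto simp: sym_capacity_eq[OF assms])

lemma chan_corr_nonneg: "dmc W \<Longrightarrow> chan_corr W d \<ge> 0"
  by (rule has_sum_nonneg[OF has_sum_chan_corr]) (simp_all add: corr_nonneg dmcD)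

lemma chan_corr_le_0: "dmc W \<Longrightarrow> chan_corr W d \<le> chan_corr W 0"
  by (rule has_sum_mono[OF has_sum_chan_corr has_sum_chan_corr]) (simp_all add: corr_le_corr_0 dmcD)

lemma sum_chan_corr:
  fixes W :: "('x::{finite,ab_group_add}, 'y) channel"
  assumes "dmc W"
  shows "(\<Sum>d\<in>UNIV. chan_corr W d) = CARD('x)"
proof -
  have "((\<lambda>y. \<Sum>d\<in>UNIV. corr (\<lambda>x. W x y) d) has_sum (\<Sum>d\<in>UNIV. chan_corr W d)) UNIV"
    using assms by (intro has_sum_sum_finite has_sum_chan_corr) auto
  then show ?thesis
    using has_sum_out[OF assms] by (simp add: sum_corr has_sum_unique)
qed

text \<open>The q correlations sum to q, and the one at 0 is the largest, so it is at least their
  average.\<close>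

lemma chan_corr_0_ge_1:
  fixes W :: "('x::{finite,ab_group_add}, 'y) channel"
  assumes "dmc W"
  shows "chan_corr W 0 \<ge> 1"
proof -
  have "real CARD('x) \<le> (\<Sum>d\<in>(UNIV::'x set). chan_corr W 0)"
    unfolding sum_chan_corr[OF assms, symmetric] by (intro sum_mono chan_corr_le_0 assms)
  then show ?thesis by simp
qed

lemma has_sum_diff_real:
  fixes f g :: "'a \<Rightarrow> real"
  shows "(f has_sum a) A \<Longrightarrow> (g has_sum b) A \<Longrightarrow> ((\<lambda>x. f x - g x) has_sum (a - b)) A"
  using has_sum_add[of f A a "\<lambda>x. - g x" "- b"] by (simp add: has_sum_uminus)

lemma chan_corr_diff_add:
  assumes "dmc W"
  shows "chan_corr W 0 - chan_corr W (d + e) \<le>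
    2 * (chan_corr W 0 - chan_corr W d) + 2 * (chan_corr W 0 - chan_corr W e)"
  by (rule has_sum_mono[OF has_sum_diff_real[OF has_sum_chan_corr[OF assms(1)] has_sum_chan_corr[OF assms(1)]] has_sum_add[OF
      has_sum_cmult_right[OF has_sum_diff_real[OF has_sum_chan_corr[OF assms(1)] has_sum_chan_corr[OF assms(1)]]]
      has_sum_cmult_right[OF has_sum_diff_real[OF has_sum_chan_corr[OF assms(1)] has_sum_chan_corr[OF assms(1)]]]]])
    (simp_all only: corr_diff_add dmcD(1)[OF assms] assms)

lemma sym_capacity_le_corr:
  fixes W :: "('x::{finite,field}, 'y) channel"
  assumes "dmc W"
  shows "sym_capacity W * ln (CARD('x)) \<le> chan_corr W 0 - 1"
proof -
  have "CARD('x) * ln (CARD('x)) - cond_ent W \<le> CARD('x) * chan_corr W 0 - CARD('x)"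
    by (rule has_sum_mono[OF has_sum_diff_real[OF has_sum_cmult_left[OF has_sum_out[OF assms(1)]] has_sum_cond_ent[OF assms]]
      has_sum_diff_real[OF has_sum_cmult_right[OF has_sum_chan_corr[OF assms(1)]] has_sum_out[OF assms]]])
      (simp_all add: ent_ge_corr dmcD assms)
  moreover have "CARD('x) * (sym_capacity W * ln (CARD('x))) = CARD('x) * ln (CARD('x)) - cond_ent W"
    using ln_CARD_pos[where 'x = 'x] by (simp add: sym_capacity_eq[OF assms] field_simps)
  ultimately have "CARD('x) * (sym_capacity W * ln (CARD('x)) + 1) \<le> CARD('x) * chan_corr W 0"
    by (simp add: algebra_simps)
  then show ?thesis by (simp add: mult_le_cancel_left_pos)
qed

lemma cond_ent_le_corr:
  fixes W :: "('x::{finite,field}, 'y) channel" and \<eta> :: real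
  assumes "dmc W" "\<eta> > 0"
  shows "cond_ent W \<le> CARD('x) * \<eta> * CARD('x) + (\<Sum>d\<in>UNIV-{0}. chan_corr W d) * (1 / \<eta>)"
  by (rule has_sum_mono[OF has_sum_cond_ent[OF assms(1)] has_sum_add[OF has_sum_cmult_right[OF has_sum_out[OF assms(1)]]
     has_sum_cmult_left[OF has_sum_sum_finite[OF _ has_sum_chan_corr[OF assms(1)]]]]])
   (use assms ent_le_corr[where 'x = 'x] in \<open>simp_all add: dmcD\<close>)

section \<open>One step of the channel transform\<close>

text \<open>The likelihood of \<open>ys\<close> with all inputs after the prefix \<open>us\<close>
  summed out. Prefixes of every length are allowed, so that all split channels are sections of one
  function and the chain rule can telescope over the prefix length.\<close>

definition tail_mass ::
    "'x::{finite,semiring_0} mat \<Rightarrow> ('x, 'y) channel \<Rightarrow> 'y list \<Rightarrow> 'x list \<Rightarrow> real" where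
  "tail_mass G W ys us =
     (\<Sum>v | length v = dim_row G - length us. vector_channel (dim_row G) W (vec_mat (us @ v) G) ys)"

lemma split_channel_eq:
  fixes G :: "'x::{finite,semiring_0} mat"
  assumes "length ys = dim_row G" "length us = i"
  shows "split_channel G W i u (ys, us) = 1 / CARD('x) ^ (dim_row G - 1) * tail_mass G W ys (us @ [u])"
  using assms by (simp add: split_channel_def tail_mass_def Let_def)

lemma split_channel_outside:
  "\<not> (length ys = dim_row G \<and> length us = i) \<Longrightarrow> split_channel G W i u (ys, us) = 0"
  by (auto simp: split_channel_def Let_def)

lemma vector_channel_nonneg: "dmc W \<Longrightarrow> vector_channel l W xs ys \<ge> 0"
  unfolding vector_channel_def by (intro prod_nonneg) (auto simp: dmcD)

lemma tail_mass_nonneg: "dmc W \<Longrightarrow> tail_mass G W ys us \<ge> 0"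
  unfolding tail_mass_def by (intro sum_nonneg vector_channel_nonneg)

lemma split_channel_nonneg: "dmc W \<Longrightarrow> split_channel G W i u z \<ge> 0"
  by (cases z) (auto simp: split_channel_def Let_def intro!: divide_nonneg_nonneg sum_nonneg vector_channel_nonneg)

lemma sum_tail_mass_snoc:
  fixes G :: "'x::{finite,semiring_0} mat"
  assumes "length us < dim_row G"
  shows "(\<Sum>u\<in>UNIV. tail_mass G W ys (us @ [u])) = tail_mass G W ys us"
proof -
  obtain n where n: "dim_row G - length us = Suc n" using assms by (metis Suc_diff_Suc)
  then have n': "dim_row G - Suc (length us) = n" by simp
  show ?thesis by (simp add: tail_mass_def n n' sum_lists_Cons)
qed

lemma has_sum_vector_channel:
  assumes "dmc W"
  shows "(vector_channel l W xs has_sum 1) {ys. length ys = l}"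
  using has_sum_prod_lists[of l "\<lambda>j. W (xs ! j)" "\<lambda>_. 1"] assms
  by (simp add: vector_channel_def[abs_def] dmcD)

lemma has_sum_Times_finite:
  fixes f :: "'a \<times> 'b \<Rightarrow> real"
  assumes B: "finite B" and f: "\<And>b. b \<in> B \<Longrightarrow> ((\<lambda>a. f (a, b)) has_sum s b) A"
  shows "(f has_sum (\<Sum>b\<in>B. s b)) (A \<times> B)"
proof -
  have "(f has_sum (\<Sum>b\<in>B. s b)) (\<Union>b\<in>B. A \<times> {b})"
  proof (rule sum_has_sum[OF B])
    fix b assume b: "b \<in> B"
    have "bij_betw (\<lambda>a. (a, b)) A (A \<times> {b})" by (auto simp: bij_betw_def inj_on_def)
    from has_sum_reindex_bij_betw[OF this, of f "s b"] show "(f has_sum s b) (A \<times> {b})"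
      using f[OF b] by simp
  qed auto
  moreover have "(\<Union>b\<in>B. A \<times> {b}) = A \<times> B" by auto
  ultimately show ?thesis by simp
qed

lemma dmc_split_channel:
  fixes G :: "'x::{finite,semiring_0} mat" and W :: "('x, 'y) channel"
  assumes W: "dmc W" and i: "i < dim_row G"
  shows "dmc (split_channel G W i)"
proof (rule dmcI)
  show "split_channel G W i u z \<ge> 0" for u z by (rule split_channel_nonneg[OF W])
next
  fix u :: 'x
  define l where "l = dim_row G"
  let ?q = "real CARD('x)"
  let ?L = "{ys :: 'y list. length ys = l} \<times> {us :: 'x list. length us = i}"
  \<comment> \<open>The q^i prefixes and the q^(l-1-i) tails together cancel the normalisation
    q^(l-1).\<close>
  have "(split_channel G W i u has_sum
     (\<Sum>us :: 'x list | length us = i. 1 / ?q ^ (l - 1) * (\<Sum>v :: 'x list | length v = l - Suc i. 1))) ?L"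
  proof (rule has_sum_Times_finite)
    fix us :: "'x list" assume us: "us \<in> {us. length us = i}"
    have "((\<lambda>ys. 1 / ?q ^ (l - 1) * (\<Sum>v | length v = l - Suc i.
        vector_channel l W (vec_mat (us @ u # v) G) ys)) has_sum
        (1 / ?q ^ (l - 1) * (\<Sum>v :: 'x list | length v = l - Suc i. 1))) {ys. length ys = l}"
      by (intro has_sum_cmult_right has_sum_sum_finite has_sum_vector_channel W) auto
    then show "((\<lambda>ys. split_channel G W i u (ys, us)) has_sum
       (1 / ?q ^ (l - 1) * (\<Sum>v :: 'x list | length v = l - Suc i. 1))) {ys. length ys = l}"
      by (rule has_sum_cong[THEN iffD1, rotated])
        (use us in \<open>simp add: split_channel_eq l_def tail_mass_def\<close>)
  qed auto
  also have "(\<Sum>us :: 'x list | length us = i. 1 / ?q ^ (l - 1) *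
      (\<Sum>v :: 'x list | length v = l - Suc i. 1)) = ?q ^ (i + (l - Suc i)) / ?q ^ (l - 1)"
    by (simp add: power_add)
  also have "i + (l - Suc i) = l - 1" using i by (simp add: l_def)
  finally have "(split_channel G W i u has_sum 1) ?L" by simp
  then show "(split_channel G W i u has_sum 1) UNIV"
    by (rule has_sum_cong_neutral[THEN iffD1, rotated 3])
      (auto simp: l_def intro: split_channel_outside)
qed

section \<open>Chain rule for conditional entropy\<close>

lemma sum_vec_mat:
  fixes G :: "'x::{finite,semiring_0} mat"
  assumes G: "dim_col G = dim_row G"
    and inj: "inj_on (\<lambda>u. vec_mat u G) {u. length u = dim_row G}"
  shows "(\<Sum>u | length u = dim_row G. g (vec_mat u G)) = (\<Sum>x | length x = dim_row G. g x)"
proof -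
  have "(\<lambda>u. vec_mat u G) ` {u. length u = dim_row G} = {x. length x = dim_row G}"
    using inj G by (intro card_subset_eq) (auto simp: card_image vec_mat_def)
  then have "bij_betw (\<lambda>u. vec_mat u G) {u. length u = dim_row G} {x. length x = dim_row G}"
    using inj by (simp add: bij_betw_def)
  then show ?thesis by (rule sum.reindex_bij_betw)
qed

lemma has_sum_ent_split_channel:
  fixes G :: "'x::{finite,semiring_0} mat" and W :: "('x, 'y) channel"
  assumes W: "dmc W" and i: "i < dim_row G"
  shows "((\<lambda>ys. 1 / CARD('x) ^ (dim_row G - 1) *
      (\<Sum>us | length us = i. ent (\<lambda>u. tail_mass G W ys (us @ [u])))) has_sum
     cond_ent (split_channel G W i)) {ys. length ys = dim_row G}"
proof -
  let ?L = "{ys. length ys = dim_row G}" and ?U = "{us :: 'x list. length us = i}"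
  have "((\<lambda>z. ent (\<lambda>u. split_channel G W i u z)) has_sum cond_ent (split_channel G W i)) UNIV"
    by (intro has_sum_cond_ent dmc_split_channel W i)
  moreover have "ent (\<lambda>u. split_channel G W i u z) = 0" if "z \<notin> ?L \<times> ?U" for z
  proof -
    have "(\<lambda>u. split_channel G W i u z) = (\<lambda>_. 0)"
      using that by (cases z) (auto intro!: split_channel_outside)
    then show ?thesis by (simp add: ent_def)
  qed
  ultimately have has: "((\<lambda>z. ent (\<lambda>u. split_channel G W i u z)) has_sum cond_ent (split_channel G W i)) (?L \<times> ?U)"
    by (subst has_sum_cong_neutral[where T = UNIV]) auto
  have ent_div: "ent (\<lambda>u. w u / c) = ent w / c" if "c \<ge> 0" "\<And>u. w u \<ge> 0" for w :: "'x \<Rightarrow> real" and c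
    using ent_scale[of "1 / c" w] that by simp
  from has have "((\<lambda>ys. \<Sum>us | length us = i. ent (\<lambda>u. split_channel G W i u (ys, us))) has_sum
      cond_ent (split_channel G W i)) ?L"
    by (rule has_sum_SigmaD) (auto intro: has_sum_finiteI)
  then show ?thesis
    by (rule has_sum_cong[THEN iffD1, rotated])
      (simp add: split_channel_eq ent_div tail_mass_nonneg[OF W] sum_divide_distrib)
qed

lemma prod_if_eq:
  fixes a b :: "nat \<Rightarrow> 'b::comm_monoid_mult"
  assumes "i < l"
  shows "(\<Prod>j<l. if j = i then a j else b j) = a i * (\<Prod>j\<in>{..<l}-{i}. b j)"
  using assms by (subst prod.remove[of _ i]) (auto intro!: arg_cong2[of _ _ _ _ "(*)"] prod.cong)

text \<open>The split channels reveal the input block one symbol at a time, so their entropies sum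
  to the entropy of the whole block. An invertible kernel merely permutes the blocks, so this is the
  entropy of l independent uses of W.\<close>

lemma sum_cond_ent_split_channel:
  fixes G :: "'x::{finite,semiring_0} mat"
  assumes W: "dmc W" and G: "dim_col G = dim_row G" "dim_row G > 0"
    and inj: "inj_on (\<lambda>u. vec_mat u G) {u. length u = dim_row G}"
  shows "(\<Sum>i<dim_row G. cond_ent (split_channel G W i)) = dim_row G * cond_ent W"
proof -
  define l where "l = dim_row G"
  let ?q = "real CARD('x)"
  let ?L = "{ys. length ys = l}"
  \<comment> \<open>Summed over prefixes, the entropy at index i is \<open>K i - K (Suc i)\<close>:
    the total mass in \<open>ent\<close> is the tail mass of the shorter prefix. Only
    \<open>K 0\<close> and \<open>K l\<close> survive the telescoping.\<close>
  define K where "K i ys = (\<Sum>us | length us = i. xlnx (tail_mass G W ys us))" for i ys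
  define S where "S y = (\<Sum>x\<in>UNIV. W x y)" for y
  have ent: "(\<Sum>us | length us = i. ent (\<lambda>u. tail_mass G W ys (us @ [u]))) = K i ys - K (Suc i) ys"
    if "i < l" for i ys
    using that by (simp add: ent_def sum_tail_mass_snoc l_def K_def sum_lists_snoc sum_subtractf)
  have tel: "(\<Sum>i<l. K i ys - K (Suc i) ys) = K 0 ys - K l ys" for ys
    by (rule sum_lessThan_telescope')
  have "((\<lambda>ys. \<Sum>i<l. 1 / ?q ^ (l - 1) * (K i ys - K (Suc i) ys)) has_sum
      (\<Sum>i<l. cond_ent (split_channel G W i))) ?L"
  proof (rule has_sum_sum_finite)
    fix i assume "i \<in> {..<l}"
    then show "((\<lambda>ys. 1 / ?q ^ (l - 1) * (K i ys - K (Suc i) ys)) has_sum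
        cond_ent (split_channel G W i)) ?L"
      using has_sum_ent_split_channel[OF W, of i G] by (simp add: ent l_def)
  qed simp
  also have "(\<lambda>ys. \<Sum>i<l. 1 / ?q ^ (l - 1) * (K i ys - K (Suc i) ys)) =
      (\<lambda>ys. 1 / ?q ^ (l - 1) * (K 0 ys - K l ys))"
    by (simp add: sum_divide_distrib [symmetric] tel)
  finally have lhs: "((\<lambda>ys. 1 / ?q ^ (l - 1) * (K 0 ys - K l ys)) has_sum
      (\<Sum>i<l. cond_ent (split_channel G W i))) ?L" .
  have K: "K 0 ys - K l ys = (\<Sum>i<l. \<Prod>j<l. if j = i then ent (\<lambda>x. W x (ys ! j)) else S (ys ! j))" for ys
  proof -
    have S0: "S y \<ge> 0" for y unfolding S_def using W by (intro sum_nonneg) (auto simp: dmcD)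
    have sets: "{us :: 'x list. us = []} = {[]}" by auto
    have "K 0 ys = xlnx (\<Sum>v | length v = l. vector_channel l W (vec_mat v G) ys)"
      by (simp add: K_def tail_mass_def l_def sets)
    also have "\<dots> = xlnx (\<Sum>x | length x = l. vector_channel l W x ys)"
      unfolding l_def by (subst sum_vec_mat[OF G(1) inj]) simp
    also have "\<dots> = xlnx (\<Prod>j<l. S (ys ! j))"
      unfolding vector_channel_def S_def by (subst sum_prod_lists) simp
    also have "\<dots> = (\<Sum>i<l. \<Prod>j<l. if j = i then xlnx (S (ys ! j)) else S (ys ! j))"
      by (intro xlnx_prod S0) auto
    finally have K0: "K 0 ys = \<dots>" .
    have "K l ys = (\<Sum>us | length us = l. xlnx (vector_channel l W (vec_mat us G) ys))"
      unfolding K_def by (intro sum.cong) (simp_all add: tail_mass_def l_def sets)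
    also have "\<dots> = (\<Sum>x | length x = l. xlnx (vector_channel l W x ys))"
      unfolding l_def by (rule sum_vec_mat[OF G(1) inj])
    also have "\<dots> = (\<Sum>x | length x = l. \<Sum>i<l. \<Prod>j<l.
        if j = i then xlnx (W (x ! j) (ys ! j)) else W (x ! j) (ys ! j))"
      unfolding vector_channel_def using W by (intro sum.cong xlnx_prod) (auto simp: dmcD)
    also have "\<dots> = (\<Sum>i<l. \<Sum>x | length x = l. \<Prod>j<l.
        (\<lambda>j x. if j = i then xlnx (W x (ys ! j)) else W x (ys ! j)) j (x ! j))"
      by (subst sum.swap) simp
    also have "\<dots> = (\<Sum>i<l. \<Prod>j<l. \<Sum>x\<in>UNIV. if j = i then xlnx (W x (ys ! j)) else W x (ys ! j))"
      by (subst sum_prod_lists) simp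
    also have "\<dots> = (\<Sum>i<l. \<Prod>j<l. if j = i then (\<Sum>x\<in>UNIV. xlnx (W x (ys ! j))) else S (ys ! j))"
      by (intro sum.cong prod.cong) (auto simp: S_def)
    finally have Kl: "K l ys = \<dots>" .
    show ?thesis
      \<comment> \<open>The two Leibniz expansions agree except in the factor at position i, where
        their difference is the entropy of one channel use.\<close>
      unfolding K0 Kl sum_subtractf [symmetric]
      by (intro sum.cong) (auto simp: prod_if_eq ent_def S_def left_diff_distrib)
  qed
  have "((\<lambda>ys. \<Sum>i<l. \<Prod>j<l. (\<lambda>j y. if j = i then ent (\<lambda>x. W x y) else S y) j (ys ! j)) has_sum
     (\<Sum>i<l. \<Prod>j<l. if j = i then cond_ent W else ?q)) ?L"
    unfolding S_def using W
    by (intro has_sum_sum_finite has_sum_prod_lists)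
      (auto simp: has_sum_cond_ent has_sum_out dmcD intro!: ent_nonneg sum_nonneg)
  also have "(\<Sum>i<l. \<Prod>j<l. if j = i then cond_ent W else ?q) = l * (?q ^ (l - 1) * cond_ent W)"
    by (simp add: prod_if_eq)
  finally have "((\<lambda>ys. 1 / ?q ^ (l - 1) * (K 0 ys - K l ys)) has_sum
      (1 / ?q ^ (l - 1) * (l * (?q ^ (l - 1) * cond_ent W)))) ?L"
    unfolding K by (intro has_sum_cmult_right) simp
  from has_sum_unique[OF this lhs] show ?thesis by (simp add: l_def)
qed

text \<open>Conservation of capacity, which is the martingale property of the capacities along a
  random path.\<close>

lemma sum_sym_capacity_split_channel:
  fixes G :: "'x::{finite,field} mat"
  assumes W: "dmc W" and G: "dim_col G = dim_row G" "dim_row G > 0"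
    and inj: "inj_on (\<lambda>u. vec_mat u G) {u. length u = dim_row G}"
  shows "(\<Sum>i<dim_row G. sym_capacity (split_channel G W i)) = dim_row G * sym_capacity W"
proof -
  have "(\<Sum>i<dim_row G. sym_capacity (split_channel G W i)) =
     (\<Sum>i<dim_row G. 1 - cond_ent (split_channel G W i) / (CARD('x) * ln (CARD('x))))"
    by (intro sum.cong) (auto simp: sym_capacity_eq dmc_split_channel W)
  also have "\<dots> = dim_row G * sym_capacity W"
    using sum_cond_ent_split_channel[OF assms]
    by (simp add: sum_subtractf sum_divide_distrib [symmetric] sym_capacity_eq[OF W] algebra_simps)
  finally show ?thesis .
qed

text \<open>For fixed u, the codeword is determined by its coordinates after the first, and the
  first one is affine in the last coordinate k and in u. Hence the posterior weights of u form a
  convolution of the weights of the first and last coordinates, mixed over the middle ones s.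
  Dimension at least two keeps first and last distinct.\<close>

lemma ent_tail_mass_singleton_ge:
  fixes G :: "'x::{finite,field} mat" and W :: "('x, 'y) channel"
  assumes W: "dmc W" and l: "dim_row G = Suc (Suc n)" "dim_col G = Suc (Suc n)"
    and inj: "inj_on (\<lambda>u. vec_mat u G) {u. length u = dim_row G}"
    and head: "\<And>u v s k. length v = Suc n \<Longrightarrow> length s = n \<Longrightarrow> tl (vec_mat (u # v) G) = s @ [k] \<Longrightarrow>
       hd (vec_mat (u # v) G) = e s - r * k - u"
    and d: "d \<noteq> 0"
  defines "S \<equiv> \<lambda>y. \<Sum>x\<in>UNIV. W x y" and "w \<equiv> \<lambda>y x. W x y"
  shows "(\<Prod>j<n. S (ys ! Suc j)) * (S (ys ! Suc n) * ent (w (ys ! 0)) +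
     corr (w (ys ! Suc n)) d * (corr (w (ys ! 0)) 0 - corr (w (ys ! 0)) (r * d)) / (2 * CARD('x)))
     \<le> ent (\<lambda>u. tail_mass G W ys [u])"
proof -
  define p where "p s = (\<Prod>j<n. W (s ! j) (ys ! Suc j))" for s
  have len: "length (vec_mat u G) = Suc (Suc n)" for u by (simp add: vec_mat_def l)
  have F: "tail_mass G W ys [u] = (\<Sum>s | length s = n. \<Sum>k\<in>UNIV. p s * w (ys ! Suc n) k * w (ys ! 0) (e s - r * k - u))" for u
  proof -
    \<comment> \<open>Replaces the summation over inputs v by one over codeword tails; T is
      injective because its value fixes the entire codeword, and counting makes it onto.\<close>
    define T where "T v = tl (vec_mat (u # v) G)" for v
    define f where "f t = W (e (butlast t) - r * last t - u) (ys ! 0) * p (butlast t) * W (last t) (ys ! Suc n)" for t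
    have T: "length (T v) = Suc n" for v by (simp add: T_def len)
    have vm: "vec_mat (u # v) G = (e (butlast (T v)) - r * last (T v) - u) # T v" if v: "length v = Suc n" for v
    proof -
      have ne: "T v \<noteq> []" "vec_mat (u # v) G \<noteq> []" using T[of v] len[of "u # v"] by auto
      have hd: "hd (vec_mat (u # v) G) = e (butlast (T v)) - r * last (T v) - u"
      proof (rule head[OF v])
        show "length (butlast (T v)) = n" using T by simp
        show "tl (vec_mat (u # v) G) = butlast (T v) @ [last (T v)]"
          using ne by (simp add: T_def)
      qed
      have "vec_mat (u # v) G = hd (vec_mat (u # v) G) # T v" using ne by (simp add: T_def)
      then show ?thesis unfolding hd .
    qed
    have injT: "inj_on T {v. length v = Suc n}"
    proof (rule inj_onI)
      fix v v' assume v: "v \<in> {v. length v = Suc n}" "v' \<in> {v. length v = Suc n}" and "T v = T v'"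
      then have "vec_mat (u # v) G = vec_mat (u # v') G" using vm by simp
      then show "v = v'" using inj_onD[OF inj, of "u # v" "u # v'"] v l by simp
    qed
    moreover have "T ` {v. length v = Suc n} = {t. length t = Suc n}"
      by (intro card_subset_eq) (use T injT in \<open>auto simp: card_image\<close>)
    ultimately have "bij_betw T {v. length v = Suc n} {t. length t = Suc n}"
      by (simp add: bij_betw_def)
    then have "(\<Sum>v | length v = Suc n. f (T v)) = (\<Sum>t | length t = Suc n. f t)"
      by (rule sum.reindex_bij_betw)
    moreover have "vector_channel (Suc (Suc n)) W (vec_mat (u # v) G) ys = f (T v)" if v: "length v = Suc n" for v
    proof -
      have "T v \<noteq> []" using T[of v] by auto
      then have "last (T v) = T v ! n" by (simp add: last_conv_nth T)
      moreover have "butlast (T v) ! j = T v ! j" if "j < n" for j using that T by (simp add: nth_butlast)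
      ultimately show ?thesis
        unfolding vector_channel_def vm[OF v] f_def p_def
        by (subst prod.lessThan_Suc_shift, subst prod.lessThan_Suc) (simp add: mult_ac)
    qed
    ultimately have "(\<Sum>v | length v = Suc n. vector_channel (Suc (Suc n)) W (vec_mat (u # v) G) ys)
        = (\<Sum>t | length t = Suc n. f t)"
      by (metis (mono_tags, lifting) mem_Collect_eq sum.cong)
    then have "tail_mass G W ys [u] = (\<Sum>t | length t = Suc n. f t)"
      by (simp add: tail_mass_def l)
    also have "\<dots> = (\<Sum>s | length s = n. \<Sum>k\<in>UNIV. f (s @ [k]))" by (rule sum_lists_snoc)
    finally show ?thesis by (simp add: f_def w_def mult_ac)
  qed
  have "(\<Sum>s | length s = n. p s) = (\<Prod>j<n. S (ys ! Suc j))"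
    unfolding p_def S_def by (rule sum_prod_lists)
  then show ?thesis
    using ent_convolution_gap[where w = "w (ys ! 0)" and v = "w (ys ! Suc n)" and T = "{s. length s = n}"
      and p = p and F = "\<lambda>u. tail_mass G W ys [u]" and e = e and r = r and d = d]
      W d F by (simp add: w_def S_def p_def dmcD prod_nonneg)
qed

text \<open>Sum the pointwise gain over all output blocks. The outputs of the first and last
  coordinate vary independently, so the product splits into separate sums, and each middle
  coordinate contributes its mass q. Normalising by q^(n+1) against q^n turns the denominator 2q
  into 2q^2.\<close>

lemma cond_ent_split_channel_0_ge:
  fixes G :: "'x::{finite,field} mat" and W :: "('x, 'y) channel"
  assumes W: "dmc W" and l: "dim_row G = Suc (Suc n)" "dim_col G = Suc (Suc n)"
    and inj: "inj_on (\<lambda>u. vec_mat u G) {u. length u = dim_row G}"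
    and head: "\<And>u v s k. length v = Suc n \<Longrightarrow> length s = n \<Longrightarrow> tl (vec_mat (u # v) G) = s @ [k] \<Longrightarrow>
       hd (vec_mat (u # v) G) = e s - r * k - u"
    and d: "d \<noteq> 0"
  shows "cond_ent W + chan_corr W d * (chan_corr W 0 - chan_corr W (r * d)) / (2 * CARD('x)\<^sup>2)
    \<le> cond_ent (split_channel G W 0)"
proof -
  define S where "S y = (\<Sum>x\<in>UNIV. W x y)" for y
  define w where "w y x = W x y" for y x
  define q where "q = real CARD('x)"
  have q: "q > 0" by (simp add: q_def)
  let ?L = "{ys :: 'y list. length ys = Suc (Suc n)}"
  define D where "D y = corr (w y) 0 - corr (w y) (r * d)" for y
  have w0: "w y x \<ge> 0" for y x using W by (simp add: w_def dmcD)
  have S: "(S has_sum q) UNIV" "S y \<ge> 0" for y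
    using has_sum_out[OF W] w0 by (auto simp: S_def[abs_def] q_def w_def intro: sum_nonneg)
  have E: "((\<lambda>y. ent (w y)) has_sum cond_ent W) UNIV" "ent (w y) \<ge> 0" for y
    using has_sum_cond_ent[OF W] ent_nonneg[of "w y"] w0 by (auto simp: w_def[abs_def])
  have C: "((\<lambda>y. corr (w y) d) has_sum chan_corr W d) UNIV" "corr (w y) d \<ge> 0" for y d
    using has_sum_chan_corr[OF W] corr_nonneg[of "w y" d] w0 by (auto simp: w_def[abs_def])
  have D: "(D has_sum (chan_corr W 0 - chan_corr W (r * d))) UNIV" "D y \<ge> 0" for y
    unfolding D_def using has_sum_diff_real[OF C(1) C(1)] corr_le_corr_0[of "w y"] w0 by auto
  have prods: "((\<lambda>ys. f (ys ! 0) * (\<Prod>j<n. S (ys ! Suc j)) * g (ys ! Suc n)) has_sum a * q ^ n * b) ?L"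
    if "(f has_sum a) UNIV" "(g has_sum b) UNIV" "\<And>y. f y \<ge> 0" "\<And>y. g y \<ge> 0"
    for f g :: "'y \<Rightarrow> real" and a b
  proof -
    define h where "h j = (if j = 0 then f else if j = Suc n then g else S)" for j
    define c where "c j = (if j = 0 then a else if j = Suc n then b else q)" for j
    have "((\<lambda>ys. \<Prod>j<Suc (Suc n). h j (ys ! j)) has_sum (\<Prod>j<Suc (Suc n). c j)) ?L"
      using that S by (intro has_sum_prod_lists) (auto simp: h_def c_def)
    moreover have "(\<Prod>j<Suc (Suc n). h j (ys ! j)) = f (ys ! 0) * (\<Prod>j<n. S (ys ! Suc j)) * g (ys ! Suc n)" for ys
      by (subst prod.lessThan_Suc_shift, subst prod.lessThan_Suc) (simp add: h_def)
    moreover have "(\<Prod>j<Suc (Suc n). c j) = a * q ^ n * b"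
      by (subst prod.lessThan_Suc_shift, subst prod.lessThan_Suc) (simp add: c_def)
    ultimately show ?thesis by simp
  qed
  have "((\<lambda>ys. 1 / q ^ Suc n * (ent (w (ys ! 0)) * (\<Prod>j<n. S (ys ! Suc j)) * S (ys ! Suc n)
        + D (ys ! 0) * (\<Prod>j<n. S (ys ! Suc j)) * corr (w (ys ! Suc n)) d * (1 / (2 * q)))) has_sum
      (1 / q ^ Suc n * (cond_ent W * q ^ n * q
        + (chan_corr W 0 - chan_corr W (r * d)) * q ^ n * chan_corr W d * (1 / (2 * q))))) ?L"
    by (rule has_sum_cmult_right[OF has_sum_add[OF prods[OF E(1) S(1) E(2) S(2)]
      has_sum_cmult_left[OF prods[OF D(1) C(1) D(2) C(2)]]]])
  moreover have "((\<lambda>ys. 1 / q ^ Suc n * ent (\<lambda>u. tail_mass G W ys [u])) has_sum cond_ent (split_channel G W 0)) ?L"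
  proof -
    have "{us :: 'x list. us = []} = {[]}" by auto
    then show ?thesis using has_sum_ent_split_channel[OF W, of 0 G] l by (simp add: q_def)
  qed
  moreover have "1 / q ^ Suc n * (ent (w (ys ! 0)) * (\<Prod>j<n. S (ys ! Suc j)) * S (ys ! Suc n)
        + D (ys ! 0) * (\<Prod>j<n. S (ys ! Suc j)) * corr (w (ys ! Suc n)) d * (1 / (2 * q)))
      \<le> 1 / q ^ Suc n * ent (\<lambda>u. tail_mass G W ys [u])" for ys
  proof (rule mult_left_mono)
    have "(\<Prod>j<n. S (ys ! Suc j)) * (S (ys ! Suc n) * ent (w (ys ! 0)) +
       corr (w (ys ! Suc n)) d * D (ys ! 0) / (2 * q)) \<le> ent (\<lambda>u. tail_mass G W ys [u])"
    proof -
      have w': "w = (\<lambda>y x. W x y)" by (intro ext) (rule w_def)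
      have q2: "2 * q = real (2 * CARD('x))" by (simp add: q_def)
      show ?thesis unfolding S_def D_def w' q2
        by (rule ent_tail_mass_singleton_ge[where e = e and r = r and n = n and G = G, OF W l inj _ d])
          (rule head; assumption)
    qed
    also have "(\<Prod>j<n. S (ys ! Suc j)) * (S (ys ! Suc n) * ent (w (ys ! 0)) +
       corr (w (ys ! Suc n)) d * D (ys ! 0) / (2 * q)) = ent (w (ys ! 0)) * (\<Prod>j<n. S (ys ! Suc j)) * S (ys ! Suc n)
        + D (ys ! 0) * (\<Prod>j<n. S (ys ! Suc j)) * corr (w (ys ! Suc n)) d * (1 / (2 * q))"
      by (simp add: algebra_simps)
    finally show "ent (w (ys ! 0)) * (\<Prod>j<n. S (ys ! Suc j)) * S (ys ! Suc n)
        + D (ys ! 0) * (\<Prod>j<n. S (ys ! Suc j)) * corr (w (ys ! Suc n)) d * (1 / (2 * q))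
      \<le> ent (\<lambda>u. tail_mass G W ys [u])" .
  qed (use q in simp)
  ultimately have "1 / q ^ Suc n * (cond_ent W * q ^ n * q
        + (chan_corr W 0 - chan_corr W (r * d)) * q ^ n * chan_corr W d * (1 / (2 * q)))
     \<le> cond_ent (split_channel G W 0)"
    by (rule has_sum_mono)
  also have "1 / q ^ Suc n * (cond_ent W * q ^ n * q
        + (chan_corr W 0 - chan_corr W (r * d)) * q ^ n * chan_corr W d * (1 / (2 * q))) =
     cond_ent W + chan_corr W d * (chan_corr W 0 - chan_corr W (r * d)) / (2 * q\<^sup>2)"
    using q by (simp add: field_simps power2_eq_square)
  finally show ?thesis by (simp add: q_def)
qed

section \<open>The iterated transform\<close>

lemma iter_channel_Nil: "iter_channel G W [] = letter_channel W"
  by (simp add: iter_channel_def)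

lemma iter_channel_snoc:
  "iter_channel G W (bs @ [b]) = block_channel (split_channel G (iter_channel G W bs) b)"
  by (simp add: iter_channel_def)

lemma has_sum_range_extend:
  assumes "inj h" "\<And>z. f (h z) = g z" "\<And>s. s \<notin> range h \<Longrightarrow> f s = 0"
  shows "(f has_sum a) UNIV \<longleftrightarrow> (g has_sum a) UNIV"
proof -
  have "(f has_sum a) UNIV \<longleftrightarrow> (f has_sum a) (range h)"
    using assms by (intro has_sum_cong_neutral) auto
  also have "\<dots> \<longleftrightarrow> ((\<lambda>z. f (h z)) has_sum a) UNIV"
    using assms(1) by (subst has_sum_reindex) (auto simp: o_def)
  finally show ?thesis by (simp add: assms(2))
qed

lemma has_sum_block:
  fixes f :: "('y, 'x) symbol \<Rightarrow> 'b::{comm_monoid_add,topological_space}"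
  assumes "\<And>ys us. f (Block ys us) = g (ys, us)" "\<And>y. f (Letter y) = 0"
  shows "(f has_sum a) UNIV \<longleftrightarrow> (g has_sum a) UNIV"
proof (rule has_sum_range_extend[where h = "\<lambda>(ys, us). Block ys us"])
  show "inj (\<lambda>(ys :: ('y, 'x) symbol list, us :: 'x list). Block ys us)" by (auto simp: inj_def)
  show "f s = 0" if "s \<notin> range (\<lambda>(ys, us). Block ys us)" for s
    using that assms by (cases s) auto
qed (use assms in auto)

lemma dmc_letter_channel:
  assumes "dmc W" shows "dmc (letter_channel W)"
proof (rule dmcI)
  show "letter_channel W x s \<ge> 0" for x s
    using assms by (cases s) (auto simp: letter_channel_def dmcD)
  fix x
  show "(letter_channel W x has_sum 1) UNIV"
    using dmcD(2)[OF assms, of x]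
  proof (subst has_sum_range_extend[where h = Letter])
    show "letter_channel W x s = 0" if "s \<notin> range Letter" for s
      using that by (cases s) (auto simp: letter_channel_def)
  qed (auto simp: letter_channel_def inj_def)
qed

lemma dmc_block_channel:
  assumes "dmc V" shows "dmc (block_channel V)"
proof (rule dmcI)
  show "block_channel V x s \<ge> 0" for x s
    using assms by (cases s) (auto simp: block_channel_def dmcD)
  show "(block_channel V x has_sum 1) UNIV" for x
    using dmcD(2)[OF assms, of x] by (subst has_sum_block) (auto simp: block_channel_def)
qed

lemma sym_capacity_block_channel:
  fixes V :: "('x::{finite,field}, ('y, 'x) symbol list \<times> 'x list) channel"
  assumes "dmc V"
  shows "sym_capacity (block_channel V) = sym_capacity V"
proof -
  have "((\<lambda>s. ent (\<lambda>x. block_channel V x s)) has_sum cond_ent V) UNIV"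
    using has_sum_cond_ent[OF assms]
    by (subst has_sum_block) (auto simp: block_channel_def ent_def)
  then have "cond_ent (block_channel V) = cond_ent V"
    using has_sum_cond_ent[OF dmc_block_channel[OF assms]] by (rule has_sum_unique[symmetric])
  then show ?thesis by (simp add: sym_capacity_eq dmc_block_channel assms)
qed

lemma dmc_iter_channel:
  fixes G :: "'x::{finite,field} mat"
  assumes "dmc W" "set bs \<subseteq> {..<dim_row G}"
  shows "dmc (iter_channel G W bs)"
  using assms(2)
proof (induction bs rule: rev_induct)
  case Nil
  show ?case unfolding iter_channel_Nil by (rule dmc_letter_channel) fact
next
  case (snoc b bs)
  have "dmc (iter_channel G W bs)" by (rule snoc.IH) (use snoc.prems in auto)
  moreover have "b < dim_row G" using snoc.prems by auto
  ultimately show ?case unfolding iter_channel_snoc by (rule dmc_block_channel[OF dmc_split_channel])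
qed

section \<open>Reed-Solomon kernels\<close>

text \<open>Primitivity speaks of integer exponents, the kernel of natural ones. With m the order of
  \<alpha>, exponents reduce modulo m and the powers below m are distinct; since they exhaust the
  non-zero elements, m = q - 1.\<close>

lemma primitive_element_power:
  fixes \<alpha> :: "'x::{finite,field}"
  assumes "primitive_element \<alpha>"
  shows "bij_betw (\<lambda>k. \<alpha> ^ k) {..<CARD('x) - 1} (UNIV - {0})" "\<alpha> ^ (CARD('x) - 1) = 1"
proof -
  have range: "range (\<lambda>k::int. \<alpha> powi k) = UNIV - {0}" using assms by (simp add: primitive_element_def)
  have \<alpha>: "\<alpha> \<noteq> 0"
  proof
    assume "\<alpha> = 0"
    then have "0 = \<alpha> powi 1" by simp
    then have "0 \<in> range (\<lambda>k::int. \<alpha> powi k)" by blast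
    then show False using range by simp
  qed
  have pow_diff: "\<alpha> ^ (j - i) = 1" if "\<alpha> ^ i = \<alpha> ^ j" "i < j" for i j
    using that \<alpha> by (simp add: power_diff)
  have ex: "\<exists>m>0. \<alpha> ^ m = 1"
  proof -
    have "\<not> inj (\<lambda>k::nat. \<alpha> ^ k)" using finite_imageD[of "\<lambda>k::nat. \<alpha> ^ k" UNIV] by auto
    then obtain i j :: nat where "i \<noteq> j" "\<alpha> ^ i = \<alpha> ^ j" by (auto simp: inj_def)
    then show ?thesis
      using pow_diff[of i j] pow_diff[of j i] by (metis linorder_neqE_nat zero_less_diff)
  qed
  define m where "m = (LEAST m. m > 0 \<and> \<alpha> ^ m = 1)"
  have m: "m > 0" "\<alpha> ^ m = 1" using LeastI_ex[OF ex] by (auto simp: m_def)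
  have m_least: "\<alpha> ^ k \<noteq> 1" if "k > 0" "k < m" for k using not_less_Least[of k] that by (auto simp: m_def)
  have inj: "inj_on (\<lambda>k. \<alpha> ^ k) {..<m}"
  proof (rule linorder_inj_onI)
    fix i j assume "i < j" "i \<in> {..<m}" "j \<in> {..<m}"
    then show "\<alpha> ^ i \<noteq> \<alpha> ^ j" using pow_diff[of i j] m_least[of "j - i"] by auto
  qed auto
  have sub: "\<alpha> powi k \<in> (\<lambda>k. \<alpha> ^ k) ` {..<m}" for k :: int
  proof -
    have "\<alpha> powi k = \<alpha> powi (int m * (k div int m) + k mod int m)" by simp
    also have "\<dots> = \<alpha> powi (int m * (k div int m)) * \<alpha> powi (k mod int m)"
      using \<alpha> by (intro power_int_add) auto
    also have "\<alpha> powi (int m * (k div int m)) = 1" using m by (simp only: power_int_mult) simp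
    also have "1 * \<alpha> powi (k mod int m) = \<alpha> powi (k mod int m)" by simp
    also have "\<dots> = \<alpha> ^ nat (k mod int m)" using m by (simp add: power_int_def)
    finally show ?thesis using m by (auto intro!: image_eqI[of _ _ "nat (k mod int m)"] simp: nat_less_iff)
  qed
  have "\<alpha> ^ k \<noteq> 0" for k using \<alpha> by simp
  moreover have "UNIV - {0} \<subseteq> (\<lambda>k. \<alpha> ^ k) ` {..<m}"
    unfolding range [symmetric] using sub by (intro image_subsetI)
  ultimately have img: "(\<lambda>k. \<alpha> ^ k) ` {..<m} = UNIV - {0}" using \<alpha> by auto
  have "m = CARD('x) - 1"
    using card_image[OF inj] by (simp add: img card_Diff_singleton)
  then show "bij_betw (\<lambda>k. \<alpha> ^ k) {..<CARD('x) - 1} (UNIV - {0})" "\<alpha> ^ (CARD('x) - 1) = 1"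
    using inj img m by (auto simp: bij_betw_def)
qed

text \<open>Columns other than the last run through the non-zero field elements in decreasing powers
  of \<alpha>; the last column belongs to the point 0, where \<open>col_scale\<close> contributes
  \<gamma>.\<close>

definition eval_point :: "'x::{finite,field} \<Rightarrow> nat \<Rightarrow> 'x" where
  "eval_point \<alpha> j = (if j \<le> CARD('x) - 2 then \<alpha> ^ (CARD('x) - 2 - j) else 0)"

definition col_scale :: "'x::{finite,field} \<Rightarrow> nat \<Rightarrow> 'x" where
  "col_scale \<gamma> j = (if j \<le> CARD('x) - 2 then 1 else \<gamma>)"

lemma bij_eval_point:
  fixes \<alpha> :: "'x::{finite,field}"
  assumes "primitive_element \<alpha>"
  shows "bij_betw (eval_point \<alpha>) {..<CARD('x)} UNIV"
proof -
  note inj = bij_betw_imp_inj_on[OF primitive_element_power(1)[OF assms]]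
    and img = bij_betw_imp_surj_on[OF primitive_element_power(1)[OF assms]]
  have q: "CARD('x) \<ge> 2" by (rule two_le_CARD)
  have nz: "\<alpha> ^ (CARD('x) - 2 - j) \<noteq> 0" for j
    using img q by (metis Diff_iff diff_less_mono2 image_eqI insertI1 lessThan_iff less_imp_diff_less
      one_less_numeral_iff semiring_norm(76) order_less_le_trans)
  have "inj_on (eval_point \<alpha>) {..<CARD('x)}"
  proof (rule inj_onI)
    fix i j assume ij: "i \<in> {..<CARD('x)}" "j \<in> {..<CARD('x)}" "eval_point \<alpha> i = eval_point \<alpha> j"
    consider "i \<le> CARD('x) - 2" "j \<le> CARD('x) - 2" | "\<not> i \<le> CARD('x) - 2" "\<not> j \<le> CARD('x) - 2"
      using ij(3) nz by (force simp: eval_point_def split: if_splits)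
    then show "i = j"
    proof cases
      case 1
      then have "CARD('x) - 2 - i = CARD('x) - 2 - j"
        using ij q by (intro inj_onD[OF inj]) (auto simp: eval_point_def)
      then show ?thesis using 1 by linarith
    next
      case 2
      then show ?thesis using ij by auto
    qed
  qed
  moreover from this have "eval_point \<alpha> ` {..<CARD('x)} = UNIV"
    by (intro card_subset_eq) (auto simp: card_image)
  ultimately show ?thesis by (simp add: bij_betw_def)
qed

section \<open>The kernel as evaluation of polynomials\<close>

lemma poly_Poly: "poly (Poly xs) x = (\<Sum>i<length xs. xs ! i * x ^ i)" for x :: "'a::comm_semiring_1"
  by (induction xs)
    (simp_all add: sum.lessThan_Suc_shift sum_distrib_left mult_ac del: sum.lessThan_Suc)

lemma rs_kernel_dim [simp]:
  fixes \<alpha> :: "'x::{finite,field}"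
  shows "dim_row (rs_kernel \<alpha> \<gamma>) = CARD('x)" "dim_col (rs_kernel \<alpha> \<gamma>) = CARD('x)"
  by (simp_all add: rs_kernel_def Let_def)

lemma length_vec_mat [simp]: "length (vec_mat u G) = dim_col G"
  by (simp add: vec_mat_def)

text \<open>Up to the scaling of its last column, the kernel evaluates the polynomial with coefficients
  \<open>u\<close>, leading coefficient first, at all points of the field.\<close>

lemma vec_mat_rs_kernel:
  fixes \<alpha> :: "'x::{finite,field}"
  assumes u: "length u = CARD('x)" and j: "j < CARD('x)"
  shows "vec_mat u (rs_kernel \<alpha> \<gamma>) ! j = col_scale \<gamma> j * poly (Poly (rev u)) (eval_point \<alpha> j)"
proof -
  define q where "q = CARD('x)"
  \<comment> \<open>In the last column the evaluation point is 0: its positive powers give the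
    zeros, and \<open>0 ^ 0 = 1\<close> gives the entry \<gamma> in the bottom row.\<close>
  have entry: "rs_kernel \<alpha> \<gamma> $$ (i, j) = col_scale \<gamma> j * eval_point \<alpha> j ^ (q - 1 - i)" if "i < q" for i
    using that j
    by (auto simp: rs_kernel_def Let_def eval_point_def col_scale_def q_def power_mult not_le)
  have "vec_mat u (rs_kernel \<alpha> \<gamma>) ! j = (\<Sum>i<q. u ! i * rs_kernel \<alpha> \<gamma> $$ (i, j))"
    using u j by (simp add: vec_mat_def scalar_prod_def q_def lessThan_atLeast0 vec_of_list_index)
  also have "\<dots> = (\<Sum>i<q. u ! i * (col_scale \<gamma> j * eval_point \<alpha> j ^ (q - 1 - i)))"
    by (intro sum.cong) (auto simp: entry)
  also have "\<dots> = (\<Sum>i<q. u ! (q - Suc i) * (col_scale \<gamma> j * eval_point \<alpha> j ^ (q - 1 - (q - Suc i))))"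
    by (rule sum.nat_diff_reindex[symmetric])
  also have "\<dots> = (\<Sum>i<q. col_scale \<gamma> j * (rev u ! i * eval_point \<alpha> j ^ i))"
    using u by (intro sum.cong) (auto simp: rev_nth q_def)
  finally show ?thesis using u by (simp add: poly_Poly sum_distrib_left q_def)
qed

lemma coeff_Poly_rev:
  "coeff (Poly (rev u)) k = (if k < length u then u ! (length u - Suc k) else 0)"
  by (simp add: nth_default_def rev_nth)

lemma card_roots_le:
  fixes p :: "'x::{finite,field} poly"
  assumes "p \<noteq> 0" "degree p \<le> n"
  shows "card {x. poly p x = 0} \<le> n"
  using card_poly_roots_bound[OF assms(1)] assms(2) by simp

text \<open>Equal codewords make the difference polynomial, of degree at most q - 1, vanish at all q
  points of the field.\<close>

lemma inj_vec_mat_rs_kernel: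
  fixes \<alpha> \<gamma> :: "'x::{finite,field}"
  assumes \<alpha>: "primitive_element \<alpha>" and \<gamma>: "\<gamma> \<noteq> 0"
  shows "inj_on (\<lambda>u. vec_mat u (rs_kernel \<alpha> \<gamma>)) {u. length u = CARD('x)}"
proof (rule inj_onI)
  fix u v :: "'x list"
  assume uv: "u \<in> {u. length u = CARD('x)}" "v \<in> {u. length u = CARD('x)}"
    and eq: "vec_mat u (rs_kernel \<alpha> \<gamma>) = vec_mat v (rs_kernel \<alpha> \<gamma>)"
  define p where "p = Poly (rev u) - Poly (rev v)"
  have "poly p (eval_point \<alpha> j) = 0" if "j < CARD('x)" for j
    using arg_cong[OF eq, of "\<lambda>xs. xs ! j"] that uv \<gamma>
    by (simp add: vec_mat_rs_kernel p_def col_scale_def split: if_splits)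
  then have "poly p x = 0" for x
    using bij_betw_imp_surj_on[OF bij_eval_point[OF \<alpha>]] by (metis UNIV_I imageE lessThan_iff)
  moreover have "degree p \<le> CARD('x) - 1"
    by (rule degree_le) (use uv in \<open>auto simp: p_def coeff_Poly_rev simp del: coeff_Poly_eq\<close>)
  ultimately have "p = 0"
    using card_roots_le[of p "CARD('x) - 1"] two_le_CARD[where 'x = 'x] by force
  then have c: "coeff (Poly (rev u)) k = coeff (Poly (rev v)) k" for k by (simp add: p_def)
  show "u = v"
  proof (rule nth_equalityI)
    fix i assume "i < length u"
    then show "u ! i = v ! i"
      using c[of "CARD('x) - Suc i"] uv by (simp add: coeff_Poly_rev del: coeff_Poly_eq)
  qed (use uv in auto)
qed

section \<open>Power sums over a finite field\<close>

lemma of_nat_CARD_field: "of_nat CARD('x) = (0 :: 'x::{finite,field})"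
proof -
  have "(\<Sum>x\<in>(UNIV :: 'x set). x) = (\<Sum>x\<in>UNIV. x + 1)"
    by (rule sum.reindex_bij_witness[of _ "\<lambda>x. x + 1" "\<lambda>x. x - 1"]) auto
  then show ?thesis by (simp add: sum.distrib)
qed

text \<open>For 0 < k < q - 1, multiplication by \<alpha> permutes the field and scales the sum by
  \<alpha>^k \<noteq> 1, so the sum is 0. For k = q - 1 every non-zero element contributes 1, giving
  q - 1 = -1.\<close>

lemma sum_powers_field:
  fixes \<alpha> :: "'x::{finite,field}"
  assumes \<alpha>: "primitive_element \<alpha>" and k: "k < CARD('x)"
  shows "(\<Sum>x\<in>(UNIV::'x set). x ^ k) = (if k = CARD('x) - 1 then -1 else 0)"
proof -
  note bij = primitive_element_power(1)[OF \<alpha>]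
  have q: "CARD('x) \<ge> 2" by (rule two_le_CARD)
  consider "k = 0" | "k = CARD('x) - 1" | "0 < k" "k < CARD('x) - 1" using k by linarith
  then show ?thesis
  proof cases
    case 1
    \<comment> \<open>Here \<open>0 ^ 0 = 1\<close>, so 0 contributes as well and the sum is q = 0
      in the field.\<close>
    then show ?thesis using q by (simp add: of_nat_CARD_field)
  next
    case 2
    have "x ^ k = 1" if "x \<noteq> 0" for x :: 'x
    proof -
      have "x \<in> (\<lambda>k. \<alpha> ^ k) ` {..<CARD('x) - 1}" 
        using that unfolding bij_betw_imp_surj_on[OF bij] by simp
      then obtain i where "x = \<alpha> ^ i" by auto
      then have "x ^ k = (\<alpha> ^ k) ^ i" by (simp add: power_mult [symmetric] mult.commute)
      then show ?thesis using primitive_element_power(2)[OF \<alpha>] 2 by simp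
    qed
    then have "(\<Sum>x\<in>(UNIV::'x set). x ^ k) = (\<Sum>x\<in>(UNIV::'x set). if x = 0 then 0 else 1)"
      using 2 q by (intro sum.cong) auto
    also have "\<dots> = (\<Sum>x\<in>(UNIV::'x set). 1 - (if x = 0 then 1 else 0))"
      by (intro sum.cong) auto
    also have "\<dots> = of_nat CARD('x) - 1" by (simp add: sum_subtractf)
    finally show ?thesis using 2 by (simp add: of_nat_CARD_field)
  next
    case 3
    have \<alpha>k: "\<alpha> ^ k \<noteq> 1"
    proof
      assume "\<alpha> ^ k = 1"
      then have "k = 0"
        using 3 by (intro inj_onD[OF bij_betw_imp_inj_on[OF bij], of k 0]) auto
      then show False using 3 by simp
    qed
    have \<alpha>0: "\<alpha> \<noteq> 0"
      using primitive_element_power(2)[OF \<alpha>] q by (auto simp: power_0_left split: if_splits)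
    have "(\<Sum>x\<in>(UNIV::'x set). x ^ k) = (\<Sum>x\<in>(UNIV::'x set). (\<alpha> * x) ^ k)"
      by (rule sum.reindex_bij_witness[of _ "\<lambda>x. \<alpha> * x" "\<lambda>x. x / \<alpha>"]) (use \<alpha>0 in auto)
    also have "\<dots> = \<alpha> ^ k * (\<Sum>x\<in>(UNIV::'x set). x ^ k)"
      by (simp add: power_mult_distrib sum_distrib_left)
    finally have "(1 - \<alpha> ^ k) * (\<Sum>x\<in>(UNIV::'x set). x ^ k) = 0" by (simp add: algebra_simps)
    then show ?thesis using \<alpha>k 3 by simp
  qed
qed

text \<open>Summing the scaled entries of \<open>u G\<close> sums the polynomial over the whole field, which
  isolates minus its coefficient of degree \<open>q - 1\<close>.\<close>

lemma hd_vec_mat_rs_kernel: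
  fixes \<alpha> \<gamma> :: "'x::{finite,field}"
  assumes \<alpha>: "primitive_element \<alpha>" and \<gamma>: "\<gamma> \<noteq> 0" and q: "CARD('x) = Suc (Suc n)"
    and v: "length v = Suc n" and s: "length s = n"
    and tl: "tl (vec_mat (u # v) (rs_kernel \<alpha> \<gamma>)) = s @ [k]"
  shows "hd (vec_mat (u # v) (rs_kernel \<alpha> \<gamma>)) = - sum_list s - inverse \<gamma> * k - u"
proof -
  define x where "x = vec_mat (u # v) (rs_kernel \<alpha> \<gamma>)"
  define p where "p = Poly (rev (u # v))"
  have x: "x = hd x # s @ [k]"
  proof -
    have "x \<noteq> []" using q by (auto simp: x_def vec_mat_def)
    then show ?thesis using tl by (metis x_def list.collapse)
  qed
  have xj: "x ! j = col_scale \<gamma> j * poly p (eval_point \<alpha> j)" if "j < CARD('x)" for j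
    unfolding x_def p_def using that v q by (intro vec_mat_rs_kernel) auto
  have "hd x + sum_list s + inverse \<gamma> * k =
      (\<Sum>j<Suc (Suc n). (if j \<le> n then 1 else inverse \<gamma>) * x ! j)"
    by (subst x, subst sum.lessThan_Suc_shift, subst sum.lessThan_Suc)
      (simp add: s nth_append sum_list_sum_nth lessThan_atLeast0 algebra_simps)
  also have "\<dots> = (\<Sum>j<CARD('x). poly p (eval_point \<alpha> j))"
    unfolding q using \<gamma> by (intro sum.cong) (auto simp: xj q col_scale_def)
  also have "\<dots> = (\<Sum>y\<in>UNIV. poly p y)"
    by (rule sum.reindex_bij_betw[OF bij_eval_point[OF \<alpha>]])
  also have "\<dots> = (\<Sum>y\<in>UNIV. \<Sum>i<CARD('x). rev (u # v) ! i * y ^ i)"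
    unfolding p_def poly_Poly by (simp add: v q)
  also have "\<dots> = (\<Sum>i<CARD('x). rev (u # v) ! i * (\<Sum>y\<in>UNIV. y ^ i))"
    by (subst sum.swap) (simp add: sum_distrib_left)
  also have "\<dots> = (\<Sum>i<CARD('x). if i = CARD('x) - 1 then - rev (u # v) ! i else 0)"
    by (intro sum.cong) (auto simp: sum_powers_field[OF \<alpha>])
  also have "\<dots> = - rev (u # v) ! (CARD('x) - 1)" using q by (simp del: sum.lessThan_Suc)
  also have "rev (u # v) ! (CARD('x) - 1) = u" using v q by (simp add: nth_append)
  finally show ?thesis by (simp add: x_def algebra_simps eq_neg_iff_add_eq_0)
qed

text \<open>The characteristic divides q and is not 1, so it equals the prime q: the additive group
  is generated by 1.\<close>

lemma of_nat_surj_prime_CARD: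
  assumes "prime CARD('x::{finite,field})"
  shows "\<exists>n. z = (of_nat n :: 'x)"
proof -
  have "CHAR('x) \<noteq> 1" by simp
  then have C: "CHAR('x) = CARD('x)"
    using of_nat_CARD_field[where 'x = 'x] assms by (metis of_nat_eq_0_iff_char_dvd prime_nat_iff)
  have "inj_on (of_nat :: nat \<Rightarrow> 'x) {..<CARD('x)}"
    by (rule inj_onI) (simp add: of_nat_eq_iff_cong_CHAR C cong_def)
  then have "(of_nat :: nat \<Rightarrow> 'x) ` {..<CARD('x)} = UNIV"
    by (intro card_subset_eq) (auto simp: card_image)
  then show ?thesis by (metis UNIV_I imageE)
qed

subsection \<open>Partial distances\<close>

text \<open>Codewords agree at a coordinate exactly where the difference polynomial has a root; the
  scaling by \<gamma> does not affect this.\<close>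

lemma hamming_dist_rs_kernel:
  fixes \<alpha> \<gamma> :: "'x::{finite,field}"
  assumes \<alpha>: "primitive_element \<alpha>" and \<gamma>: "\<gamma> \<noteq> 0"
    and u: "length u = CARD('x)" and v: "length v = CARD('x)"
  shows "hamming_dist (vec_mat u (rs_kernel \<alpha> \<gamma>)) (vec_mat v (rs_kernel \<alpha> \<gamma>)) =
     CARD('x) - card {x. poly (Poly (rev v) - Poly (rev u)) x = 0}"
proof -
  let ?p = "Poly (rev v) - Poly (rev u)"
  have "hamming_dist (vec_mat u (rs_kernel \<alpha> \<gamma>)) (vec_mat v (rs_kernel \<alpha> \<gamma>)) =
      card {j \<in> {..<CARD('x)}. poly ?p (eval_point \<alpha> j) \<noteq> 0}"
    unfolding hamming_dist_def using u v \<gamma>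
    by (intro arg_cong[where f = card])
      (auto simp: vec_mat_rs_kernel col_scale_def split: if_splits)
  also have "\<dots> = card {x. poly ?p x \<noteq> 0}"
  proof (rule bij_betw_same_card)
    show "bij_betw (eval_point \<alpha>) {j \<in> {..<CARD('x)}. poly ?p (eval_point \<alpha> j) \<noteq> 0} {x. poly ?p x \<noteq> 0}"
    proof (rule bij_betw_subset[OF bij_eval_point[OF \<alpha>]])
      show "eval_point \<alpha> ` {j \<in> {..<CARD('x)}. poly ?p (eval_point \<alpha> j) \<noteq> 0} = {x. poly ?p x \<noteq> 0}"
      proof (intro equalityI subsetI)
        fix x assume x: "x \<in> {x. poly ?p x \<noteq> 0}"
        have "x \<in> eval_point \<alpha> ` {..<CARD('x)}"
          by (simp add: bij_betw_imp_surj_on[OF bij_eval_point[OF \<alpha>]])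
        then show "x \<in> eval_point \<alpha> ` {j \<in> {..<CARD('x)}. poly ?p (eval_point \<alpha> j) \<noteq> 0}"
          using x by auto
      qed auto
    qed auto
  qed
  also have "{x. poly ?p x \<noteq> 0} = UNIV - {x. poly ?p x = 0}" by auto
  finally show ?thesis by (simp add: card_Diff_subset)
qed

text \<open>Row i carries the coefficient of degree q - 1 - i, so the two inputs differ by a monic
  polynomial of exactly that degree. It has at most q - 1 - i roots, and some such polynomial splits
  into distinct linear factors.\<close>

lemma partial_dist_rs_kernel:
  fixes \<alpha> \<gamma> :: "'x::{finite,field}"
  assumes \<alpha>: "primitive_element \<alpha>" and \<gamma>: "\<gamma> \<noteq> 0" and i: "i < CARD('x)"
  shows "partial_dist (rs_kernel \<alpha> \<gamma>) i = i + 1"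
proof -
  define q where "q = CARD('x)"
  define G where "G = rs_kernel \<alpha> \<gamma>"
  define dist where "dist v w = hamming_dist (vec_mat (replicate i 0 @ 0 # v) G) (vec_mat (replicate i 0 @ 1 # w) G)" for v w
  have iq: "i < q" using i by (simp add: q_def)
  have dist: "dist v w = q - card {x. poly (Poly (rev (replicate i 0 @ 1 # w)) - Poly (rev (replicate i 0 @ 0 # v))) x = 0}"
    if "length v = q - 1 - i" "length w = q - 1 - i" for v w
    unfolding dist_def G_def q_def using that iq
    by (intro hamming_dist_rs_kernel[OF \<alpha> \<gamma>]) (auto simp: q_def)
  let ?D = "{dist v w | v w. length v = q - 1 - i \<and> length w = q - 1 - i}"
  have "Min ?D = i + 1"
  proof (rule Min_eqI)
    have "?D \<subseteq> {..q}" using dist by auto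
    then show "finite ?D" by (rule finite_subset) simp
  next
    fix y assume "y \<in> ?D"
    then obtain v w where vw: "y = dist v w" "length v = q - 1 - i" "length w = q - 1 - i" by blast
    define p where "p = Poly (rev (replicate i 0 @ 1 # w)) - Poly (rev (replicate i 0 @ 0 # v))"
    have c: "coeff p k = (if k < q then (replicate i 0 @ 1 # w) ! (q - Suc k) - (replicate i 0 @ 0 # v) ! (q - Suc k) else 0)" for k
      unfolding p_def coeff_diff coeff_Poly_rev using vw iq by simp
    have "coeff p (q - 1 - i) = 1" using iq by (simp add: c nth_append)
    then have "p \<noteq> 0" by auto
    moreover have "degree p \<le> q - 1 - i"
    proof (rule degree_le, intro allI impI)
      fix k assume "q - 1 - i < k"
      then show "coeff p k = 0" by (auto simp: c nth_append)
    qed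
    ultimately have "card {x. poly p x = 0} \<le> q - 1 - i" by (rule card_roots_le)
    then show "i + 1 \<le> y" using dist[OF vw(2,3)] iq by (simp add: vw p_def)
  next
    \<comment> \<open>Any q - 1 - i points serve as the roots of the minimising difference.\<close>
    obtain A :: "'x set" where A: "card A = q - 1 - i"
      using obtain_subset_with_card_n[of "q - 1 - i" "UNIV :: 'x set"] by (auto simp: q_def)
    define p where "p = (\<Prod>a\<in>A. [:- a, 1:])"
    have deg: "degree p = q - 1 - i" unfolding p_def by (subst degree_prod_eq_sum_degree) (auto simp: A)
    have lead: "lead_coeff p = 1" unfolding p_def by (simp add: lead_coeff_prod)
    define v :: "'x list" where "v = replicate (q - 1 - i) 0"
    \<comment> \<open>The coefficients of p below the leading one, in descending order: the leading
      1 has degree q - 1 - i, so entry k of w has degree q - 2 - i - k.\<close>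
    define w where "w = map (\<lambda>k. coeff p (q - 2 - i - k)) [0..<q - 1 - i]"
    have "Poly (rev (replicate i 0 @ 0 # v)) = 0"
      by (rule poly_eqI, unfold coeff_Poly_rev) (auto simp: nth_append v_def nth_Cons')
    moreover have "Poly (rev (replicate i 0 @ 1 # w)) = p"
    proof (rule poly_eqI)
      fix k
      let ?u = "replicate i 0 @ 1 # w"
      have len: "length ?u = q" using iq by (simp add: w_def)
      consider "k \<ge> q" | "q - 1 - i < k" "k < q" | "k = q - 1 - i" | "k < q - 1 - i" by linarith
      then show "coeff (Poly (rev ?u)) k = coeff p k" unfolding coeff_Poly_rev len
      proof cases
        case 4
        then have "q - 2 - i - (q - Suc k - Suc i) = k" "q - Suc k - Suc i < q - 1 - i"
          "\<not> q - Suc k < i" "q - Suc k - i = Suc (q - Suc k - Suc i)" "k < q" by linarith+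
        then show "(if k < q then ?u ! (q - Suc k) else 0) = coeff p k"
          by (simp add: nth_append w_def)
      qed (use iq deg lead in \<open>auto simp: nth_append coeff_eq_0\<close>)
    qed
    ultimately have "dist v w = q - card {x. poly p x = 0}" by (subst dist) (auto simp: v_def w_def)
    also have "{x. poly p x = 0} = A" by (auto simp: p_def poly_prod)
    finally have "i + 1 = dist v w" using A iq by simp
    moreover have "length v = q - 1 - i" "length w = q - 1 - i" by (simp_all add: v_def w_def)
    ultimately show "i + 1 \<in> ?D" by blast
  qed
  then show ?thesis by (simp add: partial_dist_def dist_def G_def q_def)
qed

section \<open>The exponent and its limit\<close>

lemma exponent_rs_kernel:
  fixes \<alpha> \<gamma> :: "'x::{finite,field}"
  assumes "primitive_element \<alpha>" "\<gamma> \<noteq> 0"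
  shows "exponent (rs_kernel \<alpha> \<gamma>) = 1 / real CARD('x) * log (real CARD('x)) (fact CARD('x))"
proof -
  have "log b (fact n) = (\<Sum>i<n. log b (real (i + 1)))" for b and n :: nat
  proof (induction n)
    case (Suc n)
    have "log b (fact (Suc n)) = log b (real (Suc n)) + log b (fact n)"
      by (simp add: log_def ln_mult add_divide_distrib)
    then show ?case using Suc.IH by simp
  qed (simp add: log_def)
  then show ?thesis using assms by (simp add: exponent_def partial_dist_rs_kernel)
qed

text \<open>The bounds (l/e)^l \<le> l! \<le> l^l squeeze the value between 1 - 1/ln l and 1. The
  limit runs over all l, and so covers the field sizes q in particular.\<close>

lemma log_fact_tendsto_1: "(\<lambda>l::nat. 1 / real l * log (real l) (fact l)) \<longlonglongrightarrow> 1"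
proof (rule tendsto_sandwich)
  have ev: "eventually (\<lambda>l::nat. l \<ge> 2) sequentially" by (rule eventually_ge_at_top)
  show "eventually (\<lambda>l::nat. 1 - 1 / ln (real l) \<le> 1 / real l * log (real l) (fact l)) sequentially"
    using ev
  proof eventually_elim
    case (elim l)
    then have l: "real l > 0" "ln (real l) > 0" by auto
    \<comment> \<open>A single term of the exponential series at l gives the lower bound on l!, in
      place of Stirling's formula.\<close>
    have "real l ^ l / fact l \<le> exp (real l)"
    proof -
      have "(\<Sum>k\<in>{l}. real l ^ k /\<^sub>R fact k) \<le> exp (real l)"
        unfolding exp_def by (rule sum_le_suminf[OF summable_exp_generic]) auto
      then show ?thesis by (simp add: divide_inverse mult.commute)
    qed
    then have "ln (real l ^ l / fact l) \<le> ln (exp (real l))" using l by (subst ln_le_cancel_iff) auto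
    then have "l * ln l - l \<le> ln (fact l)" using l by (simp add: ln_div ln_realpow)
    then have "(l * ln l - l) / (l * ln l) \<le> ln (fact l) / (l * ln l)"
      using l by (intro divide_right_mono) auto
    then show ?case using l by (simp add: log_def diff_divide_distrib)
  qed
  show "eventually (\<lambda>l::nat. 1 / real l * log (real l) (fact l) \<le> 1) sequentially"
    using ev
  proof eventually_elim
    case (elim l)
    then have l: "real l > 0" "ln (real l) > 0" by auto
    have "(fact l :: real) \<le> real l ^ l" using fact_le_power[of l, where 'a = real] by simp
    then have "ln (fact l) \<le> ln (real l ^ l)" using l by (subst ln_le_cancel_iff) auto
    then have "ln (fact l) \<le> l * ln l" using l by (simp add: ln_realpow)
    then show ?case using l by (simp add: log_def field_simps)
  qed
  have "filterlim (\<lambda>l::nat. ln (real l)) at_top sequentially"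
    by (rule filterlim_compose[OF ln_at_top filterlim_real_sequentially])
  then have "(\<lambda>l::nat. 1 / ln (real l)) \<longlonglongrightarrow> 0"
    by (rule tendsto_divide_0[OF tendsto_const filterlim_at_top_imp_at_infinity])
  then show "(\<lambda>l::nat. 1 - 1 / ln (real l)) \<longlonglongrightarrow> 1"
    using tendsto_diff[OF tendsto_const, of "\<lambda>l. 1 / ln (real l)" 0 sequentially 1] by simp
qed simp

section \<open>Bounded martingales on a regular tree\<close>

definition words :: "nat \<Rightarrow> nat \<Rightarrow> nat list set" where
  "words l n = {bs. set bs \<subseteq> {..<l} \<and> length bs = n}"

lemma finite_words [simp]: "finite (words l n)"
  unfolding words_def by (rule finite_lists_length_eq) simp

lemma card_words [simp]: "card (words l n) = l ^ n"
  unfolding words_def by (subst card_lists_length_eq) auto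

lemma words_0 [simp]: "words l 0 = {[]}"
  by (auto simp: words_def)

lemma sum_words_Suc: "(\<Sum>bs\<in>words l (Suc n). g bs) = (\<Sum>i<l. \<Sum>bs\<in>words l n. g (i # bs))"
proof -
  have "bij_betw (\<lambda>(i, bs). i # bs) ({..<l} \<times> words l n) (words l (Suc n))"
    by (rule bij_betwI[where g = "\<lambda>bs. (hd bs, tl bs)"]) (auto simp: words_def length_Suc_conv)
  from sum.reindex_bij_betw[OF this, of g] show ?thesis
    by (simp add: case_prod_beta' sum.cartesian_product)
qed

lemma sum_words_add:
  "(\<Sum>bs\<in>words l (n + m). g bs) = (\<Sum>bs\<in>words l n. \<Sum>es\<in>words l m. g (bs @ es))"
  by (induction n arbitrary: g) (simp_all add: sum_words_Suc)

text \<open>A martingale for uniform choices of children, as a function on the nodes of the l-ary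
  tree. Expectations at finite depth are then finite averages over words, free of measure
  theory.\<close>

locale tree_martingale =
  fixes l :: nat and f :: "nat list \<Rightarrow> real"
  assumes l_pos: "l > 0"
    and f_bounds: "\<And>bs. set bs \<subseteq> {..<l} \<Longrightarrow> 0 \<le> f bs \<and> f bs \<le> 1"
    and f_step: "\<And>bs. set bs \<subseteq> {..<l} \<Longrightarrow> (\<Sum>i<l. f (bs @ [i])) = l * f bs"
begin

lemma sum_f: "set bs \<subseteq> {..<l} \<Longrightarrow> (\<Sum>es\<in>words l m. f (bs @ es)) = l ^ m * f bs"
proof (induction m arbitrary: bs)
  case (Suc m)
  have "(\<Sum>es\<in>words l (Suc m). f (bs @ es)) = (\<Sum>i<l. \<Sum>es\<in>words l m. f ((bs @ [i]) @ es))"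
    by (simp add: sum_words_Suc)
  also have "\<dots> = (\<Sum>i<l. l ^ m * f (bs @ [i]))"
    using Suc.prems by (intro sum.cong Suc.IH) auto
  finally show ?case by (simp add: sum_distrib_left [symmetric] f_step[OF Suc.prems])
qed simp

lemma sum_square_deviation:
  fixes c :: real
  assumes "set bs \<subseteq> {..<l}"
  shows "(\<Sum>es\<in>words l m. (f (bs @ es) - c)\<^sup>2) =
    (\<Sum>es\<in>words l m. (f (bs @ es))\<^sup>2) - 2 * c * l ^ m * f bs + l ^ m * c\<^sup>2"
  by (simp add: power2_diff sum.distrib sum_subtractf sum_distrib_left [symmetric]
      sum_distrib_right [symmetric] sum_f[OF assms] mult_ac)

text \<open>The submartingale property of the squared deviation from a constant c: the difference of
  the two sides is the sum of the squared deviations from f bs itself.\<close>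

lemma square_deviation_le:
  fixes c :: real
  assumes bs: "set bs \<subseteq> {..<l}"
  shows "l ^ m * (f bs - c)\<^sup>2 \<le> (\<Sum>es\<in>words l m. (f (bs @ es) - c)\<^sup>2)"
proof -
  have "(\<Sum>es\<in>words l m. (f (bs @ es) - c)\<^sup>2) - l ^ m * (f bs - c)\<^sup>2 =
      (\<Sum>es\<in>words l m. (f (bs @ es) - f bs)\<^sup>2)"
    unfolding sum_square_deviation[OF bs] by (simp add: power2_eq_square algebra_simps)
  also have "\<dots> \<ge> 0" by (intro sum_nonneg) auto
  finally show ?thesis by simp
qed

text \<open>Doob's maximal inequality for the submartingale \<open>(f - c)\<^sup>2\<close>: descend until the threshold is
  first exceeded.\<close>

lemma maximal_inequality:
  fixes a c :: real
  assumes "a \<ge> 0" "set bs \<subseteq> {..<l}"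
  shows "a * (\<Sum>es\<in>words l m. of_bool (\<exists>k\<le>m. a \<le> (f (bs @ take k es) - c)\<^sup>2)) \<le>
    (\<Sum>es\<in>words l m. (f (bs @ es) - c)\<^sup>2)"
  using assms(2)
proof (induction m arbitrary: bs)
  case 0
  then show ?case by simp
next
  case (Suc m)
  show ?case
  proof (cases "a \<le> (f bs - c)\<^sup>2")
    case True
    have "a * (\<Sum>es\<in>words l (Suc m). of_bool (\<exists>k\<le>Suc m. a \<le> (f (bs @ take k es) - c)\<^sup>2)) \<le>
        a * (\<Sum>es\<in>words l (Suc m). 1)"
      using assms by (intro mult_left_mono sum_mono) auto
    also have "\<dots> = l ^ Suc m * a" by simp
    also have "\<dots> \<le> l ^ Suc m * (f bs - c)\<^sup>2" using True by (intro mult_left_mono) auto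
    also have "\<dots> \<le> (\<Sum>es\<in>words l (Suc m). (f (bs @ es) - c)\<^sup>2)"
      by (rule square_deviation_le[OF Suc.prems])
    finally show ?thesis .
  next
    case False
    have eq: "(\<exists>k\<le>Suc m. a \<le> (f (bs @ take k (i # es)) - c)\<^sup>2) \<longleftrightarrow>
        (\<exists>k\<le>m. a \<le> (f ((bs @ [i]) @ take k es) - c)\<^sup>2)" for i es
    proof safe
      fix k assume "k \<le> Suc m" "a \<le> (f (bs @ take k (i # es)) - c)\<^sup>2"
      then show "\<exists>k\<le>m. a \<le> (f ((bs @ [i]) @ take k es) - c)\<^sup>2"
        using False by (cases k) auto
    next
      fix k assume "k \<le> m" "a \<le> (f ((bs @ [i]) @ take k es) - c)\<^sup>2"
      then show "\<exists>k\<le>Suc m. a \<le> (f (bs @ take k (i # es)) - c)\<^sup>2"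
        by (intro exI[of _ "Suc k"]) auto
    qed
    have "a * (\<Sum>es\<in>words l (Suc m). of_bool (\<exists>k\<le>Suc m. a \<le> (f (bs @ take k es) - c)\<^sup>2)) =
       (\<Sum>i<l. a * (\<Sum>es\<in>words l m. of_bool (\<exists>k\<le>m. a \<le> (f ((bs @ [i]) @ take k es) - c)\<^sup>2)))"
      unfolding sum_words_Suc eq by (rule sum_distrib_left)
    also have "\<dots> \<le> (\<Sum>i<l. \<Sum>es\<in>words l m. (f ((bs @ [i]) @ es) - c)\<^sup>2)"
      using Suc.prems by (intro sum_mono Suc.IH) auto
    finally show ?thesis by (simp add: sum_words_Suc)
  qed
qed

section \<open>Second moments of a bounded martingale\<close>

definition second_moment :: "nat \<Rightarrow> real" where
  "second_moment n = (\<Sum>bs\<in>words l n. (f bs)\<^sup>2) / l ^ n"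

text \<open>Increments below a node are orthogonal to its value, so their mean square is a
  difference of second moments. As these are monotone and at most 1, the increments are controlled
  by a convergent sequence.\<close>

lemma sum_square_increments:
  "(\<Sum>bs\<in>words l n. \<Sum>es\<in>words l m. (f (bs @ es) - f bs)\<^sup>2) =
    l ^ (n + m) * (second_moment (n + m) - second_moment n)"
proof -
  have "(\<Sum>bs\<in>words l n. \<Sum>es\<in>words l m. (f (bs @ es) - f bs)\<^sup>2) =
      (\<Sum>bs\<in>words l n. (\<Sum>es\<in>words l m. (f (bs @ es))\<^sup>2) - l ^ m * (f bs)\<^sup>2)"
  proof (rule sum.cong)
    fix bs assume "bs \<in> words l n"
    then have "set bs \<subseteq> {..<l}" by (simp add: words_def)
    then show "(\<Sum>es\<in>words l m. (f (bs @ es) - f bs)\<^sup>2) =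
        (\<Sum>es\<in>words l m. (f (bs @ es))\<^sup>2) - l ^ m * (f bs)\<^sup>2"
      by (simp only: sum_square_deviation) (simp add: power2_eq_square)
  qed simp
  also have "\<dots> = (\<Sum>bs\<in>words l (n + m). (f bs)\<^sup>2) - l ^ m * (\<Sum>bs\<in>words l n. (f bs)\<^sup>2)"
    by (simp add: sum_subtractf sum_words_add sum_distrib_left)
  also have "\<dots> = l ^ (n + m) * (second_moment (n + m) - second_moment n)"
    using l_pos by (simp add: second_moment_def power_add right_diff_distrib)
  finally show ?thesis .
qed

lemma second_moment_mono: "second_moment n \<le> second_moment (n + m)"
proof -
  have "0 \<le> l ^ (n + m) * (second_moment (n + m) - second_moment n)"
    unfolding sum_square_increments [symmetric] by (intro sum_nonneg) auto
  moreover have "real l ^ (n + m) > 0" using l_pos by simp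
  ultimately show ?thesis by (simp add: zero_le_mult_iff)
qed

lemma second_moment_le_1: "second_moment n \<le> 1"
proof -
  have "(\<Sum>bs\<in>words l n. (f bs)\<^sup>2) \<le> (\<Sum>bs\<in>words l n. 1)"
    using f_bounds by (intro sum_mono) (auto simp: words_def power_le_one)
  then show ?thesis using l_pos by (simp add: second_moment_def)
qed

lemma second_moment_tendsto: "\<exists>L. second_moment \<longlonglongrightarrow> L \<and> (\<forall>n. second_moment n \<le> L)"
proof -
  have inc: "incseq second_moment" by (rule incseq_SucI) (use second_moment_mono[of _ 1] in simp)
  obtain L where "second_moment \<longlonglongrightarrow> L" "\<forall>n. second_moment n \<le> L"
    using incseq_convergent[OF inc, of 1] second_moment_le_1 by metis
  then show ?thesis by metis
qed

end

section \<open>Almost sure convergence\<close>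

definition prefix_word :: "(nat \<Rightarrow> 'm \<Rightarrow> nat) \<Rightarrow> nat \<Rightarrow> 'm \<Rightarrow> nat list" where
  "prefix_word B n \<omega> = map (\<lambda>k. B k \<omega>) [1..<Suc n]"

lemma length_prefix_word [simp]: "length (prefix_word B n \<omega>) = n"
  by (simp add: prefix_word_def)

lemma take_prefix_word: "n \<le> m \<Longrightarrow> take n (prefix_word B m \<omega>) = prefix_word B n \<omega>"
  by (auto simp: prefix_word_def take_map take_upt simp del: upt_Suc)

locale uniform_letters = prob_space M for M :: "'m measure" +
  fixes l :: nat and B :: "nat \<Rightarrow> 'm \<Rightarrow> nat"
  assumes iid: "iid_uniform M l B"
begin

lemma measurable_letter: "k \<ge> 1 \<Longrightarrow> B k \<in> measurable M (count_space {..<l})"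
  using iid by (auto simp: iid_uniform_def indep_vars_def)

lemma letter_less: "k \<ge> 1 \<Longrightarrow> \<omega> \<in> space M \<Longrightarrow> B k \<omega> < l"
  using measurable_space[OF measurable_letter] by simp

lemma l_pos: "l > 0"
proof -
  obtain \<omega> where "\<omega> \<in> space M" using not_empty by auto
  then show ?thesis using letter_less[of 1 \<omega>] by simp
qed

lemma prefix_word_in_words: "\<omega> \<in> space M \<Longrightarrow> prefix_word B n \<omega> \<in> words l n"
  using letter_less by (auto simp: words_def prefix_word_def)

lemma prob_letter:
  assumes "k \<ge> 1" "i < l"
  shows "prob (B k -` {i} \<inter> space M) = 1 / l"
proof -
  have "prob (B k -` {i} \<inter> space M) = measure (distr M (count_space {..<l}) (B k)) {i}"
    using assms by (subst measure_distr[OF measurable_letter]) auto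
  also have "distr M (count_space {..<l}) (B k) = uniform_count_measure {..<l}"
    using iid assms by (simp add: iid_uniform_def)
  finally show ?thesis using assms by (simp add: measure_uniform_count_measure)
qed

lemma prefix_word_eq_iff:
  assumes "length bs = n"
  shows "prefix_word B n \<omega> = bs \<longleftrightarrow> (\<forall>k\<in>{1..n}. B k \<omega> = bs ! (k - 1))"
proof
  assume *: "\<forall>k\<in>{1..n}. B k \<omega> = bs ! (k - 1)"
  show "prefix_word B n \<omega> = bs"
    by (rule nth_equalityI) (use * assms in \<open>auto simp: prefix_word_def simp del: upt_Suc\<close>)
next
  assume "prefix_word B n \<omega> = bs"
  then show "\<forall>k\<in>{1..n}. B k \<omega> = bs ! (k - 1)"
    by (auto simp: prefix_word_def simp del: upt_Suc)
qed

lemma prefix_word_event: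
  assumes bs: "bs \<in> words l n"
  shows "{\<omega> \<in> space M. prefix_word B n \<omega> = bs} \<in> events"
    and "prob {\<omega> \<in> space M. prefix_word B n \<omega> = bs} = 1 / l ^ n"
proof -
  have len: "length bs = n" and lt: "\<And>k. k < n \<Longrightarrow> bs ! k < l"
    using bs by (auto simp: words_def subset_iff)
  have ev: "B k -` {bs ! (k - 1)} \<inter> space M \<in> events" if "k \<in> {1..n}" for k
    using that lt by (intro measurable_sets[OF measurable_letter]) auto
  have "{\<omega> \<in> space M. prefix_word B n \<omega> = bs} \<in> events \<and>
    prob {\<omega> \<in> space M. prefix_word B n \<omega> = bs} = 1 / l ^ n"
  proof (cases "n = 0")
    case True
    then show ?thesis using len by (simp add: prefix_word_def prob_space)
  next
    case False
    have eq: "{\<omega> \<in> space M. prefix_word B n \<omega> = bs} = (\<Inter>k\<in>{1..n}. B k -` {bs ! (k - 1)} \<inter> space M)"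
      using False by (auto simp: prefix_word_eq_iff[OF len])
    have "prob (\<Inter>k\<in>{1..n}. B k -` {bs ! (k - 1)} \<inter> space M) =
        (\<Prod>k\<in>{1..n}. prob (B k -` {bs ! (k - 1)} \<inter> space M))"
      using iid False lt
      by (intro indep_varsD[where M' = "\<lambda>_. count_space {..<l}" and I = "{1..}"]) (auto simp: iid_uniform_def)
    also have "\<dots> = (\<Prod>k\<in>{1..n}. 1 / l)" using lt by (intro prod.cong prob_letter) auto
    also have "\<dots> = 1 / l ^ n" by (simp add: power_one_over)
    finally have "prob (\<Inter>k\<in>{1..n}. B k -` {bs ! (k - 1)} \<inter> space M) = 1 / l ^ n" .
    moreover have "(\<Inter>k\<in>{1..n}. B k -` {bs ! (k - 1)} \<inter> space M) \<in> events"
      using ev False by (intro sets.finite_INT) auto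
    ultimately show ?thesis unfolding eq by blast
  qed
  then show "{\<omega> \<in> space M. prefix_word B n \<omega> = bs} \<in> events"
    "prob {\<omega> \<in> space M. prefix_word B n \<omega> = bs} = 1 / l ^ n" by auto
qed

lemma word_event:
  shows "{\<omega> \<in> space M. Q (prefix_word B n \<omega>)} \<in> events"
    and "prob {\<omega> \<in> space M. Q (prefix_word B n \<omega>)} = (\<Sum>bs\<in>words l n. of_bool (Q bs)) / l ^ n"
proof -
  let ?W = "{bs \<in> words l n. Q bs}"
  have eq: "{\<omega> \<in> space M. Q (prefix_word B n \<omega>)} = (\<Union>bs\<in>?W. {\<omega> \<in> space M. prefix_word B n \<omega> = bs})"
    using prefix_word_in_words by auto
  show "{\<omega> \<in> space M. Q (prefix_word B n \<omega>)} \<in> events"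
    unfolding eq using prefix_word_event by (intro sets.finite_UN) auto
  have "prob {\<omega> \<in> space M. Q (prefix_word B n \<omega>)} = (\<Sum>bs\<in>?W. prob {\<omega> \<in> space M. prefix_word B n \<omega> = bs})"
    unfolding eq using prefix_word_event
    by (intro finite_measure_finite_Union) (auto simp: disjoint_family_on_def)
  also have "\<dots> = (\<Sum>bs\<in>?W. 1 / l ^ n)" by (intro sum.cong prefix_word_event) auto
  finally show "prob {\<omega> \<in> space M. Q (prefix_word B n \<omega>)} = (\<Sum>bs\<in>words l n. of_bool (Q bs)) / l ^ n"
    by (simp add: Int_def)
qed

lemma borel_measurable_word [measurable]: "(\<lambda>\<omega>. g (prefix_word B n \<omega>) :: real) \<in> borel_measurable M"
  unfolding borel_measurable_iff_le by (intro allI word_event(1))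

end

locale bounded_martingale = uniform_letters M l B + tree_martingale l f
  for M :: "'m measure" and l B f
begin

text \<open>The event depends on the first n + m letters only, so its probability is a word count.
  Below each word \<open>bs\<close> of length n the maximal inequality applies with centre c = f bs;
  then average over \<open>bs\<close>.\<close>

lemma prob_deviation_le:
  assumes "\<epsilon> > 0"
  shows "prob {\<omega> \<in> space M. \<exists>k\<le>m. \<epsilon> \<le> \<bar>f (prefix_word B (n + k) \<omega>) - f (prefix_word B n \<omega>)\<bar>} \<le>
    (second_moment (n + m) - second_moment n) / \<epsilon>\<^sup>2"
proof -
  define Q where "Q ws \<longleftrightarrow> (\<exists>k\<le>m. \<epsilon>\<^sup>2 \<le> (f (take (n + k) ws) - f (take n ws))\<^sup>2)" for ws
  have abs: "\<epsilon> \<le> \<bar>x\<bar> \<longleftrightarrow> \<epsilon>\<^sup>2 \<le> x\<^sup>2" for x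
    using assms abs_le_square_iff[of \<epsilon> x] by simp
  have "(\<exists>k\<le>m. \<epsilon> \<le> \<bar>f (prefix_word B (n + k) \<omega>) - f (prefix_word B n \<omega>)\<bar>) \<longleftrightarrow> Q (prefix_word B (n + m) \<omega>)" for \<omega>
    unfolding Q_def abs by (intro ex_cong1) (auto simp: take_prefix_word)
  then have "prob {\<omega> \<in> space M. \<exists>k\<le>m. \<epsilon> \<le> \<bar>f (prefix_word B (n + k) \<omega>) - f (prefix_word B n \<omega>)\<bar>} =
      (\<Sum>bs\<in>words l n. \<Sum>es\<in>words l m. of_bool (Q (bs @ es))) / l ^ (n + m)"
    by (simp add: word_event(2) sum_words_add)
  also have "(\<Sum>bs\<in>words l n. \<Sum>es\<in>words l m. of_bool (Q (bs @ es))) =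
      (\<Sum>bs\<in>words l n. (\<Sum>es\<in>words l m. of_bool (\<exists>k\<le>m. \<epsilon>\<^sup>2 \<le> (f (bs @ take k es) - f bs)\<^sup>2)))"
    by (intro sum.cong) (auto simp: Q_def words_def)
  also have "\<dots> \<le> (\<Sum>bs\<in>words l n. (\<Sum>es\<in>words l m. (f (bs @ es) - f bs)\<^sup>2) / \<epsilon>\<^sup>2)"
  proof (rule sum_mono)
    fix bs assume "bs \<in> words l n"
    then have "\<epsilon>\<^sup>2 * (\<Sum>es\<in>words l m. of_bool (\<exists>k\<le>m. \<epsilon>\<^sup>2 \<le> (f (bs @ take k es) - f bs)\<^sup>2)) \<le>
        (\<Sum>es\<in>words l m. (f (bs @ es) - f bs)\<^sup>2)"
      by (intro maximal_inequality) (auto simp: words_def)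
    then show "(\<Sum>es\<in>words l m. of_bool (\<exists>k\<le>m. \<epsilon>\<^sup>2 \<le> (f (bs @ take k es) - f bs)\<^sup>2)) \<le>
        (\<Sum>es\<in>words l m. (f (bs @ es) - f bs)\<^sup>2) / \<epsilon>\<^sup>2"
      using assms by (simp add: pos_le_divide_eq mult.commute)
  qed
  also have "\<dots> = l ^ (n + m) * (second_moment (n + m) - second_moment n) / \<epsilon>\<^sup>2"
    by (simp add: sum_divide_distrib [symmetric] sum_square_increments)
  finally have "prob {\<omega> \<in> space M. \<exists>k\<le>m. \<epsilon> \<le> \<bar>f (prefix_word B (n + k) \<omega>) - f (prefix_word B n \<omega>)\<bar>} \<le>
      l ^ (n + m) * (second_moment (n + m) - second_moment n) / \<epsilon>\<^sup>2 / l ^ (n + m)"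
    by (simp add: divide_right_mono)
  also have "\<dots> = (second_moment (n + m) - second_moment n) / \<epsilon>\<^sup>2" using l_pos by simp
  finally show ?thesis .
qed

text \<open>Cauchy criterion: the probability that some later value differs by \<epsilon> from the
  n-th one is at most the remaining second moment over \<epsilon>^2, which tends to 0. Almost surely
  some n therefore has no such deviation.\<close>

lemma AE_convergent: "AE \<omega> in M. convergent (\<lambda>n. f (prefix_word B n \<omega>))"
proof -
  obtain L where L: "second_moment \<longlonglongrightarrow> L" "\<And>n. second_moment n \<le> L"
    using second_moment_tendsto by blast
  define A where "A \<epsilon> n = {\<omega> \<in> space M. \<exists>k. \<epsilon> \<le> \<bar>f (prefix_word B (n + k) \<omega>) - f (prefix_word B n \<omega>)\<bar>}" for \<epsilon> n
  have A[measurable]: "A \<epsilon> n \<in> events" for \<epsilon> n unfolding A_def by measurable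
  have le: "prob (A \<epsilon> n) \<le> (L - second_moment n) / \<epsilon>\<^sup>2" if "\<epsilon> > 0" for \<epsilon> n
  proof -
    \<comment> \<open>The maximal inequality covers finite horizons only; these events increase to
      the one with unbounded horizon.\<close>
    define C where "C m = {\<omega> \<in> space M. \<exists>k\<le>m. \<epsilon> \<le> \<bar>f (prefix_word B (n + k) \<omega>) - f (prefix_word B n \<omega>)\<bar>}" for m
    have "C m \<in> events" for m unfolding C_def by measurable
    then have "(\<lambda>m. prob (C m)) \<longlonglongrightarrow> prob (\<Union>m. C m)"
      by (intro finite_Lim_measure_incseq) (auto simp: incseq_def C_def intro: order_trans)
    moreover have "(\<Union>m. C m) = A \<epsilon> n" by (auto simp: C_def A_def)
    ultimately have "(\<lambda>m. prob (C m)) \<longlonglongrightarrow> prob (A \<epsilon> n)" by simp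
    moreover have "prob (C m) \<le> (L - second_moment n) / \<epsilon>\<^sup>2" for m
    proof -
      have "prob (C m) \<le> (second_moment (n + m) - second_moment n) / \<epsilon>\<^sup>2"
        unfolding C_def by (rule prob_deviation_le) fact
      also have "\<dots> \<le> (L - second_moment n) / \<epsilon>\<^sup>2" using L by (intro divide_right_mono) auto
      finally show ?thesis .
    qed
    ultimately show ?thesis by (intro LIMSEQ_le_const2) auto
  qed
  have "AE \<omega> in M. \<exists>n. \<omega> \<notin> A \<epsilon> n" if "\<epsilon> > 0" for \<epsilon>
  proof -
    have "prob (\<Inter>n. A \<epsilon> n) \<le> (L - second_moment n) / \<epsilon>\<^sup>2" for n
      using finite_measure_mono[of "\<Inter>n. A \<epsilon> n" "A \<epsilon> n"] le[OF that, of n] by (auto intro: order_trans)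
    moreover have "(\<lambda>n. (L - second_moment n) / \<epsilon>\<^sup>2) \<longlonglongrightarrow> (L - L) / \<epsilon>\<^sup>2"
      using L(1) that by (intro tendsto_intros) auto
    ultimately have "prob (\<Inter>n. A \<epsilon> n) \<le> 0" by (intro LIMSEQ_le_const[where X = "\<lambda>n. (L - second_moment n) / \<epsilon>\<^sup>2"]) auto
    then have "(\<Inter>n. A \<epsilon> n) \<in> null_sets M"
      by (simp add: null_sets_def emeasure_eq_measure measure_le_0_iff)
    then have "AE \<omega> in M. \<omega> \<notin> (\<Inter>n. A \<epsilon> n)" by (rule AE_not_in)
    then show ?thesis by simp
  qed
  then have "AE \<omega> in M. \<forall>j. \<exists>n. \<omega> \<notin> A (inverse (Suc j)) n"
    by (simp add: AE_all_countable)
  then show ?thesis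
    using AE_space
  proof eventually_elim
    case (elim \<omega>)
    show "convergent (\<lambda>n. f (prefix_word B n \<omega>))"
      unfolding Cauchy_convergent_iff [symmetric]
    proof (rule metric_CauchyI)
      fix e :: real assume "e > 0"
      then obtain j where j: "inverse (real (Suc j)) < e / 2"
        using reals_Archimedean[of "e / 2"] by auto
      obtain n where "\<omega> \<notin> A (inverse (Suc j)) n" using elim by blast
      then have n: "\<bar>f (prefix_word B (n + k) \<omega>) - f (prefix_word B n \<omega>)\<bar> < e / 2" for k
      proof -
        have "\<bar>f (prefix_word B (n + k) \<omega>) - f (prefix_word B n \<omega>)\<bar> < inverse (Suc j)"
          using elim \<open>\<omega> \<notin> A (inverse (Suc j)) n\<close> by (auto simp: A_def not_le)
        then show ?thesis using j by linarith
      qed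
      have "dist (f (prefix_word B m \<omega>)) (f (prefix_word B m' \<omega>)) < e" if "m \<ge> n" "m' \<ge> n" for m m'
      proof -
        have "\<bar>f (prefix_word B m \<omega>) - f (prefix_word B n \<omega>)\<bar> < e / 2"
          "\<bar>f (prefix_word B m' \<omega>) - f (prefix_word B n \<omega>)\<bar> < e / 2"
          using n[of "m - n"] n[of "m' - n"] that by simp_all
        then show ?thesis unfolding dist_real_def by linarith
      qed
      then show "\<exists>N. \<forall>m\<ge>N. \<forall>n\<ge>N. dist (f (prefix_word B m \<omega>)) (f (prefix_word B n \<omega>)) < e"
        by blast
    qed
  qed
qed

text \<open>The node \<open>bs @ [0]\<close> is usually off the path, so convergence along the path
  does not settle this. Its squared increment is one of the l non-negative terms over all children;
  hence its mean is at most l times the growth of the second moment. That is summable, and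
  Borel-Cantelli applies.\<close>

lemma AE_first_child_increment_tendsto_0:
  "AE \<omega> in M. (\<lambda>n. f (prefix_word B n \<omega> @ [0]) - f (prefix_word B n \<omega>)) \<longlonglongrightarrow> 0"
proof -
  obtain L where L: "second_moment \<longlonglongrightarrow> L" "\<And>n. second_moment n \<le> L"
    using second_moment_tendsto by blast
  have lpos: "real l > 0" and zero: "[0] \<in> words l 1" using l_pos by (simp_all add: words_def)
  define D where "D bs = f (bs @ [0]) - f bs" for bs
  define A where "A \<epsilon> n = {\<omega> \<in> space M. \<epsilon> \<le> \<bar>D (prefix_word B n \<omega>)\<bar>}" for \<epsilon> n
  have le: "prob (A \<epsilon> n) \<le> l * (second_moment (Suc n) - second_moment n) / \<epsilon>\<^sup>2" if \<epsilon>: "\<epsilon> > 0" for \<epsilon> n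
  proof -
    have "prob (A \<epsilon> n) = (\<Sum>bs\<in>words l n. of_bool (\<epsilon> \<le> \<bar>D bs\<bar>)) / l ^ n"
      unfolding A_def by (rule word_event(2))
    also have "(\<Sum>bs\<in>words l n. of_bool (\<epsilon> \<le> \<bar>D bs\<bar>)) \<le>
        (\<Sum>bs\<in>words l n. (\<Sum>es\<in>words l 1. (f (bs @ es) - f bs)\<^sup>2) / \<epsilon>\<^sup>2)"
    proof (rule sum_mono)
      fix bs assume "bs \<in> words l n"
      have "of_bool (\<epsilon> \<le> \<bar>D bs\<bar>) \<le> (D bs)\<^sup>2 / \<epsilon>\<^sup>2"
        using \<epsilon> abs_le_square_iff[of \<epsilon> "D bs"] by auto
      also have "(D bs)\<^sup>2 \<le> (\<Sum>es\<in>words l 1. (f (bs @ es) - f bs)\<^sup>2)"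
        unfolding D_def using zero
        by (intro member_le_sum[of "[0]" _ "\<lambda>es. (f (bs @ es) - f bs)\<^sup>2"]) auto
      finally show "of_bool (\<epsilon> \<le> \<bar>D bs\<bar>) \<le> (\<Sum>es\<in>words l 1. (f (bs @ es) - f bs)\<^sup>2) / \<epsilon>\<^sup>2"
        using \<epsilon> by (simp add: divide_right_mono)
    qed
    also have "\<dots> = l ^ n * (l * (second_moment (Suc n) - second_moment n) / \<epsilon>\<^sup>2)"
      using sum_square_increments[where n = n and m = 1] by (simp add: sum_divide_distrib [symmetric])
    finally show ?thesis using lpos by (simp add: divide_right_mono)
  qed
  have "AE \<omega> in M. eventually (\<lambda>n. \<omega> \<in> space M - A \<epsilon> n) sequentially" if "\<epsilon> > 0" for \<epsilon>
  proof (rule borel_cantelli_AE1)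
    show "A \<epsilon> n \<in> events" for n unfolding A_def by (rule word_event(1))
    show "emeasure M (A \<epsilon> n) < \<infinity>" for n by (simp add: emeasure_eq_measure)
    have "summable (\<lambda>n. second_moment (Suc n) - second_moment n)"
      using L(1) by (rule telescope_summable)
    then have "summable (\<lambda>n. l * (second_moment (Suc n) - second_moment n) / \<epsilon>\<^sup>2)"
      by (rule summable_divide[OF summable_mult])
    then show "summable (\<lambda>n. prob (A \<epsilon> n))"
      by (rule summable_comparison_test'[where N = 0]) (simp add: le[OF that])
  qed
  then have "AE \<omega> in M. \<forall>j. eventually (\<lambda>n. \<omega> \<in> space M - A (inverse (Suc j)) n) sequentially"
    by (simp add: AE_all_countable)
  then show ?thesis
  proof eventually_elim
    case (elim \<omega>)
    show ?case
    proof (rule tendstoI)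
      fix e :: real assume "e > 0"
      then obtain j where j: "inverse (real (Suc j)) < e" using reals_Archimedean by blast
      have "eventually (\<lambda>n. \<omega> \<in> space M - A (inverse (Suc j)) n) sequentially" using elim by blast
      then show "eventually (\<lambda>n. dist (f (prefix_word B n \<omega> @ [0]) - f (prefix_word B n \<omega>)) 0 < e) sequentially"
        by eventually_elim (use j in \<open>auto simp: A_def D_def\<close>)
    qed
  qed
qed

end

section \<open>Polarization\<close>

text \<open>The factor 2q^2 stems from the entropy gain, the factor q ln q from the conversion of
  entropy into capacity.\<close>

lemma capacity_gain:
  fixes \<alpha> \<gamma> :: "'x::{finite,field}" and V :: "('x, 'z) channel"
  assumes \<alpha>: "primitive_element \<alpha>" and \<gamma>: "\<gamma> \<noteq> 0" and V: "dmc V" and d: "d \<noteq> 0"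
  shows "chan_corr V d * (chan_corr V 0 - chan_corr V (inverse \<gamma> * d)) \<le>
    2 * CARD('x)\<^sup>2 * (CARD('x) * ln (CARD('x))) *
      (sym_capacity V - sym_capacity (split_channel (rs_kernel \<alpha> \<gamma>) V 0))"
proof -
  obtain n where n: "CARD('x) = Suc (Suc n)"
    using two_le_CARD[where 'x = 'x] by (metis add_2_eq_Suc le_Suc_ex)
  have "cond_ent V + chan_corr V d * (chan_corr V 0 - chan_corr V (inverse \<gamma> * d)) / (2 * CARD('x)\<^sup>2)
    \<le> cond_ent (split_channel (rs_kernel \<alpha> \<gamma>) V 0)"
  proof (rule cond_ent_split_channel_0_ge[where n = n and e = "\<lambda>s. - sum_list s", OF V _ _ _ _ d])
    show "inj_on (\<lambda>u. vec_mat u (rs_kernel \<alpha> \<gamma>)) {u. length u = dim_row (rs_kernel \<alpha> \<gamma>)}"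
      using inj_vec_mat_rs_kernel[OF \<alpha> \<gamma>] by simp
  qed (simp_all add: n hd_vec_mat_rs_kernel[OF \<alpha> \<gamma> n])
  then have "chan_corr V d * (chan_corr V 0 - chan_corr V (inverse \<gamma> * d)) \<le>
      2 * CARD('x)\<^sup>2 * (cond_ent (split_channel (rs_kernel \<alpha> \<gamma>) V 0) - cond_ent V)"
    by (simp add: field_simps)
  also have "dmc (split_channel (rs_kernel \<alpha> \<gamma>) V 0)"
    using V by (intro dmc_split_channel) auto
  then have "cond_ent (split_channel (rs_kernel \<alpha> \<gamma>) V 0) - cond_ent V =
     CARD('x) * ln (CARD('x)) * (sym_capacity V - sym_capacity (split_channel (rs_kernel \<alpha> \<gamma>) V 0))"
    using ln_CARD_pos[where 'x = 'x] V by (simp add: sym_capacity_eq field_simps)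
  finally show ?thesis by (simp add: mult.assoc)
qed

text \<open>Along a path with \<open>chan_corr (V n) d\<close> bounded away from \<open>0\<close>, the posterior becomes invariant
  under translation by \<open>r d\<close>. Invariances add up, and invariance under \<open>e\<close> bounds
  \<open>chan_corr (V n) e\<close> away from \<open>0\<close> again, so it passes from \<open>e\<close> to \<open>r e\<close>.\<close>

lemma translation_invariance_spreads:
  fixes V :: "nat \<Rightarrow> ('x::{finite,field}, 'z) channel"
  assumes V: "\<And>n. dmc (V n)" and F: "F \<le> sequentially" and r: "r \<noteq> 0" and d: "d \<noteq> 0" and \<delta>: "\<delta> > 0"
    and gain: "\<And>d. d \<noteq> 0 \<Longrightarrow>
      (\<lambda>n. chan_corr (V n) d * (chan_corr (V n) 0 - chan_corr (V n) (r * d))) \<longlonglongrightarrow> 0"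
    and F_d: "eventually (\<lambda>n. \<delta> \<le> chan_corr (V n) d) F"
    and gen: "prime CARD('x) \<or> primitive_element (inverse r)"
  shows "((\<lambda>n. chan_corr (V n) 0 - chan_corr (V n) e) \<longlongrightarrow> 0) F"
proof -
  define T where "T n e = chan_corr (V n) 0 - chan_corr (V n) e" for n e
  have T_nonneg: "T n e \<ge> 0" for n e using chan_corr_le_0[OF V] by (simp add: T_def)
  have gainF: "((\<lambda>n. chan_corr (V n) d * T n (r * d)) \<longlongrightarrow> 0) F" if "d \<noteq> 0" for d
    using filterlim_mono[OF gain[OF that] order_refl F] by (simp add: T_def)
  \<comment> \<open>The product tends to 0 and its first factor stays above \<delta>, so the second
    factor tends to 0.\<close>
  have step: "((\<lambda>n. T n (r * d)) \<longlongrightarrow> 0) F"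
    if d: "d \<noteq> 0" and \<delta>: "\<delta> > 0" and ev: "eventually (\<lambda>n. \<delta> \<le> chan_corr (V n) d) F" for d \<delta>
  proof (rule tendsto_sandwich[where f = "\<lambda>_. 0"])
    show "eventually (\<lambda>n. T n (r * d) \<le> chan_corr (V n) d * T n (r * d) / \<delta>) F"
      using ev
    proof eventually_elim
      case (elim n)
      then have "\<delta> * T n (r * d) \<le> chan_corr (V n) d * T n (r * d)"
        using T_nonneg by (intro mult_right_mono) auto
      then show ?case using \<delta> by (simp add: pos_le_divide_eq mult.commute)
    qed
    show "((\<lambda>n. chan_corr (V n) d * T n (r * d) / \<delta>) \<longlongrightarrow> 0) F"
      using tendsto_divide[OF gainF[OF d] tendsto_const[of \<delta>]] \<delta> by simp
  qed (use T_nonneg in auto)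
  note first = step[OF d \<delta> F_d]
  show ?thesis
  proof (cases "e = 0")
    case False
    from gen show ?thesis
    proof
      assume "prime CARD('x)"
      \<comment> \<open>For prime q the single invariance under r * d generates the whole additive
        group.\<close>
      then obtain m where "e / (r * d) = of_nat m" using of_nat_surj_prime_CARD by blast
      then have e: "e = of_nat m * (r * d)" using r d by (simp add: field_simps)
      have "((\<lambda>n. T n (of_nat m * (r * d))) \<longlongrightarrow> 0) F" for m
      proof (induction m)
        case 0
        then show ?case by (simp add: T_def)
      next
        case (Suc m)
        show ?case
        proof (rule tendsto_sandwich[where f = "\<lambda>_. 0"])
          show "eventually (\<lambda>n. T n (of_nat (Suc m) * (r * d)) \<le> 2 * T n (r * d) + 2 * T n (of_nat m * (r * d))) F"
            using chan_corr_diff_add[OF V] by (intro always_eventually) (auto simp: T_def ring_distribs(2))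
          show "((\<lambda>n. 2 * T n (r * d) + 2 * T n (of_nat m * (r * d))) \<longlongrightarrow> 0) F"
            using tendsto_add[OF tendsto_mult_left[OF first, of 2] tendsto_mult_left[OF Suc.IH, of 2]] by simp
        qed (use T_nonneg in auto)
      qed
      then show ?thesis by (simp add: e T_def)
    next
      assume prim: "primitive_element (inverse r)"
      let ?q = "CARD('x)"
      have "e / d \<noteq> 0" using False d by simp
      then have "e / d \<in> (\<lambda>k. inverse r ^ k) ` {..<?q - 1}"
        unfolding bij_betw_imp_surj_on[OF primitive_element_power(1)[OF prim]] by simp
      then obtain k where k: "k < ?q - 1" "e / d = inverse r ^ k" by auto
      \<comment> \<open>The first known invariance is under r^1 * d, so e/d is needed as a positive
        power of r. It is the k-th power of \<open>inverse r\<close>, hence r^(q-1-k), and k < q - 1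
        keeps this exponent positive.\<close>
      have "r ^ (?q - 1) = 1"
        using primitive_element_power(2)[OF prim] r by (simp add: power_inverse)
      moreover have "?q - 1 = Suc (?q - 2 - k) + k" using k by simp
      then have "r ^ (?q - 1) = r ^ Suc (?q - 2 - k) * r ^ k" by (simp only: power_add)
      ultimately have "r ^ k * r ^ Suc (?q - 2 - k) = 1" by (simp add: mult.commute)
      then have "e / d = r ^ Suc (?q - 2 - k)"
        unfolding k(2) power_inverse by (rule inverse_unique)
      then have e: "e = r ^ Suc (?q - 2 - k) * d" using d by (simp add: field_simps)
      have "((\<lambda>n. T n (r ^ Suc m * d)) \<longlongrightarrow> 0) F" for m
      proof (induction m)
        case 0
        then show ?case using first by simp
      next
        case (Suc m)
        \<comment> \<open>Since the correlation at 0 is at least 1, a loss below 1/2 leaves a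
          correlation of at least 1/2; any threshold strictly between 0 and 1 would serve.\<close>
        have "eventually (\<lambda>n. T n (r ^ Suc m * d) < 1 / 2) F"
          using order_tendstoD(2)[OF Suc.IH, of "1 / 2"] by simp
        then have "eventually (\<lambda>n. 1 / 2 \<le> chan_corr (V n) (r ^ Suc m * d)) F"
        proof eventually_elim
          case (elim n)
          then show ?case using chan_corr_0_ge_1[OF V, of n] by (simp add: T_def)
        qed
        from step[OF _ _ this] show ?case using r d by (simp add: mult.assoc)
      qed
      then show ?thesis unfolding e T_def [symmetric] .
    qed
  qed simp
qed

text \<open>If all off-diagonal correlations vanish in the limit, the posterior degenerates and L =
  1. Otherwise one of them stays large along a subsequence; there the posterior becomes uniform, and
  since the capacities converge, the subsequence already determines L = 0.\<close>

lemma capacity_limit_0_or_1: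
  fixes V :: "nat \<Rightarrow> ('x::{finite,field}, 'z) channel"
  assumes V: "\<And>n. dmc (V n)" and r: "r \<noteq> 0"
    and gain: "\<And>d. d \<noteq> 0 \<Longrightarrow>
      (\<lambda>n. chan_corr (V n) d * (chan_corr (V n) 0 - chan_corr (V n) (r * d))) \<longlonglongrightarrow> 0"
    and gen: "prime CARD('x) \<or> primitive_element (inverse r)"
    and L: "(\<lambda>n. sym_capacity (V n)) \<longlonglongrightarrow> L"
  shows "L \<in> {0, 1}"
proof (cases "\<forall>d. d \<noteq> 0 \<longrightarrow> (\<lambda>n. chan_corr (V n) d) \<longlonglongrightarrow> 0")
  case True
  define Q where "Q = real CARD('x)"
  have lnQ: "ln Q > 0" "Q > 0" using ln_CARD_pos[where 'x = 'x] by (simp_all add: Q_def)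
  \<comment> \<open>The limit in n is taken for fixed \<eta>, because the correlation term carries
    the factor 1/\<eta>; only afterwards does \<eta> shrink.\<close>
  have "1 - L \<le> Q * \<eta> / ln Q" if \<eta>: "\<eta> > 0" for \<eta>
  proof (rule tendsto_le[OF trivial_limit_sequentially])
    show "(\<lambda>n. 1 - sym_capacity (V n)) \<longlonglongrightarrow> 1 - L" by (intro tendsto_intros L)
    have "(\<lambda>n. (Q * \<eta> * Q + (\<Sum>d\<in>UNIV-{0}. chan_corr (V n) d) * (1 / \<eta>)) / (Q * ln Q)) \<longlonglongrightarrow>
        (Q * \<eta> * Q + (\<Sum>d\<in>UNIV-{0::'x}. 0) * (1 / \<eta>)) / (Q * ln Q)"
      using lnQ True by (intro tendsto_intros tendsto_sum) auto
    then show "(\<lambda>n. (Q * \<eta> * Q + (\<Sum>d\<in>UNIV-{0}. chan_corr (V n) d) * (1 / \<eta>)) / (Q * ln Q))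
        \<longlonglongrightarrow> Q * \<eta> / ln Q"
      using lnQ by simp
    show "eventually (\<lambda>n. 1 - sym_capacity (V n) \<le>
        (Q * \<eta> * Q + (\<Sum>d\<in>UNIV-{0}. chan_corr (V n) d) * (1 / \<eta>)) / (Q * ln Q)) sequentially"
      using cond_ent_le_corr[OF V \<eta>] lnQ
      by (intro always_eventually allI) (simp add: sym_capacity_eq[OF V] Q_def [symmetric] divide_right_mono)
  qed
  then have "1 - L \<le> e" if "e > 0" for e
    using that lnQ by (metis divide_pos_pos mult_pos_pos nonzero_mult_div_cancel_right
        nonzero_mult_div_cancel_left times_divide_eq_right less_numeral_extra(3))
  then have "1 - L \<le> 0" by (rule field_le_epsilon) simp
  moreover have "L \<le> 1" using L sym_capacity_bounds(2)[OF V] by (intro LIMSEQ_le_const2) auto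
  ultimately show ?thesis by simp
next
  case False
  define Q where "Q = real CARD('x)"
  have lnQ: "ln Q > 0" "Q > 0" using ln_CARD_pos[where 'x = 'x] by (simp_all add: Q_def)
  obtain d where d: "d \<noteq> 0" "\<not> (\<lambda>n. chan_corr (V n) d) \<longlonglongrightarrow> 0" using False by auto
  obtain \<delta> where \<delta>: "\<delta> > 0" "\<not> eventually (\<lambda>n. dist (chan_corr (V n) d) 0 < \<delta>) sequentially"
    using d(2) by (auto simp: tendsto_iff)
  \<comment> \<open>A filter in place of a subsequence: F restricts \<open>sequentially\<close> to
    the indices with correlation at least \<delta>, and is proper because there are infinitely many
    of them.\<close>
  define F where "F = inf sequentially (principal {n. \<delta> \<le> chan_corr (V n) d})"
  have F: "F \<le> sequentially" by (simp add: F_def)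
  have "F \<noteq> bot"
    using \<delta>(2) chan_corr_nonneg[OF V]
    by (simp add: F_def trivial_limit_def eventually_inf_principal not_le)
  have "eventually (\<lambda>n. \<delta> \<le> chan_corr (V n) d) F" by (simp add: F_def eventually_inf_principal)
  then have T: "((\<lambda>n. chan_corr (V n) 0 - chan_corr (V n) e) \<longlongrightarrow> 0) F" for e
    using gain by (intro translation_invariance_spreads[OF V F r d(1) \<delta>(1) _ _ gen])
  \<comment> \<open>The correlations have average 1, so the mean loss over all shifts is the
    correlation at 0 minus 1, which bounds the capacity.\<close>
  have "((\<lambda>n. (\<Sum>e\<in>UNIV. chan_corr (V n) 0 - chan_corr (V n) e) / Q) \<longlongrightarrow> (\<Sum>e\<in>(UNIV :: 'x set). 0) / Q) F"
    using lnQ by (intro tendsto_intros tendsto_sum T) auto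
  moreover have "(\<Sum>e\<in>UNIV. chan_corr (V n) 0 - chan_corr (V n) e) / Q = chan_corr (V n) 0 - 1" for n
    using lnQ by (simp add: sum_subtractf sum_chan_corr[OF V] Q_def field_simps)
  ultimately have lim: "((\<lambda>n. chan_corr (V n) 0 - 1) \<longlongrightarrow> 0) F" by simp
  have LF: "((\<lambda>n. sym_capacity (V n)) \<longlongrightarrow> L) F" by (rule filterlim_mono[OF L order_refl F])
  have "L * ln Q \<le> 0"
    by (rule tendsto_le[OF \<open>F \<noteq> bot\<close> lim tendsto_mult_right[OF LF]])
      (use sym_capacity_le_corr[OF V] in \<open>simp add: Q_def\<close>)
  moreover have "L \<ge> 0" using L sym_capacity_bounds(1)[OF V] by (intro LIMSEQ_le_const) auto
  ultimately show ?thesis using lnQ by (simp add: mult_le_0_iff)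
qed

lemma polarizes_rs_kernel:
  fixes \<alpha> \<gamma> :: "'x::{finite,field}" and W :: "('x, 'y) channel" and M :: "'m measure"
  assumes \<alpha>: "primitive_element \<alpha>" and \<gamma>: "\<gamma> \<noteq> 0" and gen: "prime CARD('x) \<or> primitive_element \<gamma>"
    and M: "prob_space M" "iid_uniform M CARD('x) B" and W: "dmc W"
  shows "polarizes M B (rs_kernel \<alpha> \<gamma>) W"
proof -
  define G where "G = rs_kernel \<alpha> \<gamma>"
  define V where "V bs = iter_channel G W bs" for bs
  define f where "f bs = sym_capacity (V bs)" for bs
  have V: "dmc (V bs)" if "set bs \<subseteq> {..<CARD('x)}" for bs
    unfolding V_def using W that by (intro dmc_iter_channel) (auto simp: G_def)
  have f_snoc: "f (bs @ [i]) = sym_capacity (split_channel G (V bs) i)"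
    if "set bs \<subseteq> {..<CARD('x)}" "i < CARD('x)" for bs i
    unfolding f_def V_def iter_channel_snoc using V[OF that(1)] that(2)
    by (intro sym_capacity_block_channel dmc_split_channel) (auto simp: G_def V_def)
  interpret prob_space M by fact
  interpret bounded_martingale M "CARD('x)" B f
  proof unfold_locales
    show "iid_uniform M CARD('x) B" by fact
    show "CARD('x) > 0" by simp
    fix bs :: "nat list" assume bs: "set bs \<subseteq> {..<CARD('x)}"
    show "0 \<le> f bs \<and> f bs \<le> 1" using sym_capacity_bounds[OF V[OF bs]] by (simp add: f_def)
    have "(\<Sum>i<dim_row G. sym_capacity (split_channel G (V bs) i)) = dim_row G * sym_capacity (V bs)"
      using inj_vec_mat_rs_kernel[OF \<alpha> \<gamma>]
      by (intro sum_sym_capacity_split_channel V bs) (auto simp: G_def)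
    moreover have "(\<Sum>i<CARD('x). f (bs @ [i])) = (\<Sum>i<dim_row G. sym_capacity (split_channel G (V bs) i))"
      using f_snoc[OF bs] by (intro sum.cong) (auto simp: G_def)
    ultimately show "(\<Sum>i<CARD('x). f (bs @ [i])) = CARD('x) * f bs"
      by (simp add: G_def f_def)
  qed
  have process: "capacity_process G W B n \<omega> = f (prefix_word B n \<omega>)" for n \<omega>
    by (simp add: capacity_process_def f_def V_def prefix_word_def)
  have conv: "AE \<omega> in M. (\<lambda>n. f (prefix_word B n \<omega>)) \<longlonglongrightarrow> capacity_limit G W B \<omega>"
    using AE_convergent by eventually_elim (simp add: capacity_limit_def process convergent_LIMSEQ_iff)
  have ae: "AE \<omega> in M. capacity_limit G W B \<omega> \<in> {0, 1}"
    using conv AE_first_child_increment_tendsto_0 AE_space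
  proof eventually_elim
    case (elim \<omega>)
    have words: "set (prefix_word B n \<omega>) \<subseteq> {..<CARD('x)}" for n
      using prefix_word_in_words[OF elim(3), of n] by (simp add: words_def)
    define U where "U n = V (prefix_word B n \<omega>)" for n
    have U: "dmc (U n)" for n unfolding U_def by (rule V[OF words])
    have child: "f (prefix_word B n \<omega> @ [0]) = sym_capacity (split_channel (rs_kernel \<alpha> \<gamma>) (U n) 0)" for n
      using f_snoc[OF words] by (simp add: U_def G_def)
    have parent: "f (prefix_word B n \<omega>) = sym_capacity (U n)" for n by (simp add: f_def U_def)
    show ?case
    proof (rule capacity_limit_0_or_1[OF U, where r = "inverse \<gamma>"])
      show "(\<lambda>n. sym_capacity (U n)) \<longlonglongrightarrow> capacity_limit G W B \<omega>"
        using elim(1) by (simp add: parent)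
      fix d :: 'x assume d: "d \<noteq> 0"
      let ?C = "2 * (real CARD('x))\<^sup>2 * (CARD('x) * ln (CARD('x)))"
      show "(\<lambda>n. chan_corr (U n) d * (chan_corr (U n) 0 - chan_corr (U n) (inverse \<gamma> * d))) \<longlonglongrightarrow> 0"
      \<comment> \<open>The product is non-negative and at most a constant times the capacity lost
        by the child with index 0, which tends to 0 almost surely.\<close>
      proof (rule tendsto_sandwich[where f = "\<lambda>_. 0"])
        show "eventually (\<lambda>n. 0 \<le> chan_corr (U n) d * (chan_corr (U n) 0 - chan_corr (U n) (inverse \<gamma> * d))) sequentially"
          using chan_corr_nonneg[OF U] chan_corr_le_0[OF U] by (intro always_eventually) simp
        show "eventually (\<lambda>n. chan_corr (U n) d * (chan_corr (U n) 0 - chan_corr (U n) (inverse \<gamma> * d)) \<le>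
            ?C * (- (f (prefix_word B n \<omega> @ [0]) - f (prefix_word B n \<omega>)))) sequentially"
          using capacity_gain[OF \<alpha> \<gamma> U d]
          by (intro always_eventually) (simp add: child parent)
        show "(\<lambda>n. ?C * (- (f (prefix_word B n \<omega> @ [0]) - f (prefix_word B n \<omega>)))) \<longlonglongrightarrow> 0"
          using tendsto_mult_left[OF tendsto_minus[OF elim(2)], of ?C] by simp
      qed simp
    qed (use \<gamma> gen in auto)
  qed
  \<comment> \<open>Measurability has to be checked, since \<open>measure\<close> defaults to 0 on
    sets that are not events.\<close>
  have "{\<omega> \<in> space M. capacity_limit G W B \<omega> \<in> {0, 1}} \<in> events"
  proof -
    have [measurable]: "capacity_limit G W B \<in> borel_measurable M"
      unfolding capacity_limit_def[abs_def] process by (rule borel_measurable_lim_metric) (rule borel_measurable_word)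
    show ?thesis by measurable
  qed
  then have "prob {\<omega> \<in> space M. capacity_limit G W B \<omega> \<in> {0, 1}} = 1"
    using ae by (rule prob_Collect_eq_1[THEN iffD2])
  then show ?thesis using conv unfolding polarizes_def G_def [symmetric] process by blast
qed

theorem mainTheorem4:
  fixes \<alpha> \<gamma> :: "'x::{finite,field}"
  assumes "primitive_element \<alpha>" and "\<gamma> \<noteq> 0"
  shows
    "(\<forall>(M :: 'm measure) B (W :: ('x, 'y::countable) channel).
        prob_space M \<longrightarrow> iid_uniform M CARD('x) B \<longrightarrow> dmc W \<longrightarrow>
        (prime CARD('x) \<longrightarrow> polarizes M B (rs_kernel \<alpha> \<gamma>) W) \<and>
        (primitive_element \<gamma> \<longrightarrow> polarizes M B (rs_kernel \<alpha> \<gamma>) W)) \<and>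
     (\<forall>i<CARD('x). partial_dist (rs_kernel \<alpha> \<gamma>) i = i + 1) \<and>
     exponent (rs_kernel \<alpha> \<gamma>) = 1 / real CARD('x) * log (real CARD('x)) (fact CARD('x)) \<and>
     (\<lambda>l::nat. 1 / real l * log (real l) (fact l)) \<longlonglongrightarrow> 1"
proof (intro conjI allI impI)
  fix M :: "'m measure" and B and W :: "('x, 'y) channel"
  assume W: "prob_space M" "iid_uniform M CARD('x) B" "dmc W"
  show "polarizes M B (rs_kernel \<alpha> \<gamma>) W" if "prime CARD('x)"
    using that W by (intro polarizes_rs_kernel assms disjI1)
  show "polarizes M B (rs_kernel \<alpha> \<gamma>) W" if "primitive_element \<gamma>"
    using that W by (intro polarizes_rs_kernel assms disjI2)
qed (use partial_dist_rs_kernel[OF assms] exponent_rs_kernel[OF assms] log_fact_tendsto_1 in auto)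

end
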